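(* Let $A$ be an infeasible linear pencil of size $\alpha$ in $n$ variables, i.e. $S_A=\emptyset$. Then $$-1\in M_A^{(2^{\min\{\alpha-1,\,n\}}-1)}.$$
   Context: Let $\mathtt{x}=(\mathtt{x}_1,\dots,\mathtt{x}_n)$ be commuting variables, $\mathbb{R}[\mathtt{x}]$ the polynomial ring and $\mathbb{R}[\mathtt{x}]_k$ the space of polynomials of degree at most $k$. A linear pencil of size $\alpha$ is a symmetric matrix $A\in\mathbb{R}[\mathtt{x}]^{\alpha\times\alpha}$ with entries in $\mathbb{R}[\mathtt{x}]_1$; its spectrahedron is $S_A:=\{x\in\mathbb{R}^n\mid A(x)\succeq0\}$ ($\succeq0$ means positive semidefinite), and $A$ is called infeasible if $S_A=\emptyset$. For $k\in\mathbb{N}_0$ the truncated quadratic module with degree restriction $k$ associated to $A$ is $$M_A^{(k)}:=\Big\{\sum_ip_i^2+\sum_jv_j^*Av_j\ \Big|\ p_i\in\mathbb{R}[\mathtt{x}]_k,\ v_j\in\mathbb{R}[\mathtt{x}]_k^\alpha\Big\}\subseteq\mathbb{R}[\mathtt{x}]_{2k+1}$$ (finite sums; $^*$ is transpose; $\mathbb{R}[\mathtt{x}]_k^\alpha$ is the set of column vectors of length $\alpha$ with entries in $\mathbb{R}[\mathtt{x}]_k$). *)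

theory Defs
  imports "Jordan_Normal_Form.Matrix" "HOL-Library.Poly_Mapping"
begin

(* A polynomial is the finitely supported map from exponent vectors to coefficients; an
   exponent vector is itself a finitely supported map from variable indices to exponents.
   With these instances of poly_mapping the library's + and * are the polynomial operations.
   The variable x_i is represented by the index i - 1, so n variables are the indices {..<n}. *)
type_synonym mpoly = "(nat \<Rightarrow>\<^sub>0 nat) \<Rightarrow>\<^sub>0 real"

definition polys :: "nat \<Rightarrow> mpoly set" where
  "polys n = {p. \<forall>m \<in> Poly_Mapping.keys p. Poly_Mapping.keys m \<subseteq> {..<n}}"

(* Here the zero polynomial has degree 0, so it lies in every polys_le n k, as it should. *)
definition total_degree :: "mpoly \<Rightarrow> nat" where
  "total_degree p = Max (insert 0 ((\<lambda>m. \<Sum>i\<in>Poly_Mapping.keys m. Poly_Mapping.lookup m i) ` Poly_Mapping.keys p))"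

definition polys_le :: "nat \<Rightarrow> nat \<Rightarrow> mpoly set" where
  "polys_le n k = {p \<in> polys n. total_degree p \<le> k}"

definition poly_eval :: "real vec \<Rightarrow> mpoly \<Rightarrow> real" where
  "poly_eval x p = (\<Sum>m\<in>Poly_Mapping.keys p. Poly_Mapping.lookup p m * (\<Prod>i\<in>Poly_Mapping.keys m. (x $ i) ^ Poly_Mapping.lookup m i))"

definition linear_pencil :: "nat \<Rightarrow> nat \<Rightarrow> mpoly mat \<Rightarrow> bool" where
  "linear_pencil n \<alpha> A \<longleftrightarrow> A \<in> carrier_mat \<alpha> \<alpha> \<and> transpose_mat A = A \<and>
     (\<forall>i<\<alpha>. \<forall>j<\<alpha>. A $$ (i, j) \<in> polys_le n 1)"

definition pos_semidef :: "real mat \<Rightarrow> bool" where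
  "pos_semidef B \<longleftrightarrow> transpose_mat B = B \<and>
     (\<forall>u \<in> carrier_vec (dim_row B). 0 \<le> u \<bullet> (B *\<^sub>v u))"

definition spectrahedron :: "nat \<Rightarrow> mpoly mat \<Rightarrow> real vec set" where
  "spectrahedron n A = {x \<in> carrier_vec n. pos_semidef (map_mat (poly_eval x) A)}"

definition infeasible :: "nat \<Rightarrow> mpoly mat \<Rightarrow> bool" where
  "infeasible n A \<longleftrightarrow> spectrahedron n A = {}"

definition poly_vecs_le :: "nat \<Rightarrow> nat \<Rightarrow> nat \<Rightarrow> mpoly vec set" where
  "poly_vecs_le n k \<alpha> = {v \<in> carrier_vec \<alpha>. \<forall>i<\<alpha>. v $ i \<in> polys_le n k}"

(* The degree restriction is on the p_i and v_j, not on the resulting sum. *)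
definition trunc_quadratic_module :: "nat \<Rightarrow> nat \<Rightarrow> mpoly mat \<Rightarrow> mpoly set" where
  "trunc_quadratic_module n k A =
     {(\<Sum>p\<leftarrow>ps. p ^ 2) + (\<Sum>v\<leftarrow>vs. v \<bullet> (A *\<^sub>v v)) | ps vs.
        set ps \<subseteq> polys_le n k \<and> set vs \<subseteq> poly_vecs_le n k (dim_row A)}"

end

theory Submission
  imports Defs "HOL-Analysis.Function_Topology"
begin

text \<open>
  The induction runs over pairs \<open>(I, L)\<close> of an index set \<open>I\<close> and a space \<open>L\<close> of affine polynomials
  such that the principal submatrix \<open>A\<^sub>I\<close> is nowhere positive semidefinite on the zero set of \<open>L\<close>.
  Separating \<open>L\<close> from the compact convex set of all \<open>\<langle>A\<^sub>I, B\<rangle> + c\<close> with \<open>B\<close> positive semidefinite,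
  \<open>c \<ge> 0\<close> and \<open>tr B + c = 1\<close> would give a point of this zero set where \<open>A\<^sub>I\<close> is positive definite. So the
  two meet: some \<open>c + \<Sum> u\<^sup>T A u\<close> lies in \<open>L\<close>. If \<open>c > 0\<close> this is a certificate of degree \<open>0\<close>.
  Otherwise pick a summand \<open>u\<close> with \<open>u\<^sub>i \<noteq> 0\<close>; then \<open>u\<^sup>T A u\<close> is zero up to certificates of degree \<open>0\<close>, which
  forces \<open>-\<rho>\<^sub>j\<^sup>2\<close> into the module of degree \<open>1\<close> for every entry \<open>\<rho>\<^sub>j\<close> of \<open>A u\<close>. Adding all \<open>\<rho>\<^sub>j\<close> to \<open>L\<close>
  allows the index \<open>i\<close> to be dropped. If this enlarges \<open>L\<close>, then both the size and the dimension of
  the zero set decrease, and a certificate \<open>-1 - h\<close> with \<open>h = \<Sum> \<rho>\<^sub>j q\<^sub>j\<close> is repaired by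
  \<open>-1 = 2 (-1 - h) + (1 + h)\<^sup>2 - h\<^sup>2\<close>, which takes the degree \<open>k\<close> to \<open>2 k + 1\<close>.
\<close>

section \<open>Positive semidefinite forms\<close>

text \<open>The index set is a separate argument of the form, so passing to a principal submatrix
  only shrinks \<open>I\<close> and leaves the matrix as it is.\<close>

definition quad_form :: "nat set \<Rightarrow> (nat \<Rightarrow> nat \<Rightarrow> 'a::comm_ring_1) \<Rightarrow> (nat \<Rightarrow> 'a) \<Rightarrow> 'a" where
  "quad_form I B u = (\<Sum>i\<in>I. \<Sum>j\<in>I. u i * B i j * u j)"

lemma quad_form_insert:
  assumes "finite I" "a \<notin> I" and sym: "\<And>j. j \<in> I \<Longrightarrow> B j a = B a j"
  shows "quad_form (insert a I) B u =
    B a a * (u a)\<^sup>2 + 2 * u a * (\<Sum>j\<in>I. B a j * u j) + quad_form I B u"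
proof -
  have "(\<Sum>j\<in>I. u j * B j a * u a) = u a * (\<Sum>j\<in>I. B a j * u j)"
    by (simp add: sum_distrib_left sym mult_ac)
  moreover have "(\<Sum>j\<in>I. u a * B a j * u j) = u a * (\<Sum>j\<in>I. B a j * u j)"
    by (simp add: sum_distrib_left mult_ac)
  ultimately show ?thesis
    using assms(1,2) by (simp add: quad_form_def sum.distrib power2_eq_square algebra_simps)
qed

lemma quad_form_cong:
  "(\<And>i j. i \<in> I \<Longrightarrow> j \<in> I \<Longrightarrow> B i j = C i j) \<Longrightarrow> (\<And>i. i \<in> I \<Longrightarrow> u i = v i)
    \<Longrightarrow> quad_form I B u = quad_form I C v"
  by (simp add: quad_form_def)

lemma quad_form_remove:
  assumes "finite I" "i \<in> I" "u i = 0"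
  shows "quad_form I B u = quad_form (I - {i}) B u"
  using assms(3) by (simp add: quad_form_def sum.remove[OF assms(1,2)])

lemma quad_form_add:
  assumes "\<And>i j. i \<in> I \<Longrightarrow> j \<in> I \<Longrightarrow> B i j = B j i"
  shows "quad_form I B (\<lambda>i. x i + y i) =
    quad_form I B x + 2 * (\<Sum>j\<in>I. (\<Sum>i\<in>I. x i * B i j) * y j) + quad_form I B y"
proof -
  define s where "s = (\<Sum>i\<in>I. \<Sum>j\<in>I. x i * B i j * y j)"
  have "(\<Sum>i\<in>I. \<Sum>j\<in>I. y i * B i j * x j) = (\<Sum>j\<in>I. \<Sum>i\<in>I. y i * B i j * x j)"
    by (rule sum.swap)
  also have "\<dots> = s"
    unfolding s_def by (intro sum.cong refl) (simp add: assms mult_ac)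
  finally have 1: "(\<Sum>i\<in>I. \<Sum>j\<in>I. y i * B i j * x j) = s" .
  have 2: "(\<Sum>j\<in>I. (\<Sum>i\<in>I. x i * B i j) * y j) = s"
    unfolding s_def sum_distrib_right by (rule sum.swap)
  have "(x i + y i) * B i j * (x j + y j) =
    x i * B i j * x j + x i * B i j * y j + y i * B i j * x j + y i * B i j * y j" for i j
    by (simp add: algebra_simps)
  then have "quad_form I B (\<lambda>i. x i + y i) = quad_form I B x + s +
      (\<Sum>i\<in>I. \<Sum>j\<in>I. y i * B i j * x j) + quad_form I B y"
    by (simp add: quad_form_def s_def sum.distrib)
  then show ?thesis by (simp add: 1 2)
qed

lemma quad_form_scale: "quad_form I B (\<lambda>i. p * v i) = p\<^sup>2 * quad_form I B v"
  by (simp add: quad_form_def sum_distrib_left power2_eq_square mult_ac)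

lemma quad_form_superset:
  assumes "finite I'" "I \<subseteq> I'"
  shows "quad_form I' B (\<lambda>i. if i \<in> I then v i else 0) = quad_form I B v"
proof -
  let ?v = "\<lambda>i. if i \<in> I then v i else 0"
  have "quad_form I' B ?v = (\<Sum>i\<in>I. \<Sum>j\<in>I'. ?v i * B i j * ?v j)"
    unfolding quad_form_def by (rule sum.mono_neutral_right) (use assms in auto)
  also have "\<dots> = (\<Sum>i\<in>I. \<Sum>j\<in>I. ?v i * B i j * ?v j)"
    by (intro sum.cong refl sum.mono_neutral_right) (use assms in auto)
  also have "\<dots> = quad_form I B v" by (simp add: quad_form_def)
  finally show ?thesis .
qed

text \<open>An affine function of \<open>t\<close> that is bounded below has slope zero; the chosen
  \<open>t\<close> would give it the value \<open>-1\<close>. This makes the row of a zero diagonal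
  entry vanish in a positive semidefinite matrix.\<close>

lemma linear_form_zero:
  fixes b c :: real
  assumes "\<And>t. 0 \<le> 2 * t * b + c"
  shows "b = 0"
proof (rule ccontr)
  assume "b \<noteq> 0"
  then show False using assms[of "- (c + 1) / (2 * b)"] by (simp add: field_simps)
qed

text \<open>Cholesky decomposition by induction on the index set. If the new diagonal entry is zero,
  so is its row. Otherwise a rank one matrix with the same row is split off, and the Schur
  complement that remains is positive semidefinite again.\<close>

lemma psd_rank_one_decomposition:
  fixes B :: "nat \<Rightarrow> nat \<Rightarrow> real"
  assumes "finite I" "\<And>i j. i \<in> I \<Longrightarrow> j \<in> I \<Longrightarrow> B i j = B j i" "\<And>u. 0 \<le> quad_form I B u"
  shows "\<exists>us. \<forall>i\<in>I. \<forall>j\<in>I. B i j = (\<Sum>u\<leftarrow>us. u i * u j)"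
  using assms
proof (induction I arbitrary: B rule: finite_induct)
  case empty
  then show ?case by simp
next
  case (insert a I)
  have ins: "quad_form (insert a I) B u =
    B a a * (u a)\<^sup>2 + 2 * u a * (\<Sum>j\<in>I. B a j * u j) + quad_form I B u" for u
    by (rule quad_form_insert) (use insert in auto)
  show ?case
  proof (cases "B a a = 0")
    case True
    have "B a k = 0" if "k \<in> I" for k
    proof (rule linear_form_zero[where c = "B k k"])
      fix t :: real
      \<comment> \<open>At \<open>t e_a + e_k\<close> the form is
        \<open>2 * t * B a k + B k k\<close>, because \<open>B a a = 0\<close>.\<close>
      define u where "u = (\<lambda>i. if i = a then t else if i = k then 1 else 0 :: real)"
      have ua: "u a = t" and "k \<noteq> a" using that insert by (auto simp: u_def)
      have "(\<Sum>j\<in>I. B a j * u j) = (\<Sum>j\<in>I. if j = k then B a k else 0)"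
        by (rule sum.cong) (use insert in \<open>auto simp: u_def\<close>)
      then have s: "(\<Sum>j\<in>I. B a j * u j) = B a k" using that insert by simp
      have "quad_form I B u = (\<Sum>i\<in>I. if i = k then B k k else 0)"
        unfolding quad_form_def
      proof (rule sum.cong)
        fix i assume "i \<in> I"
        have "(\<Sum>j\<in>I. u i * B i j * u j) = (\<Sum>j\<in>I. if j = k then u i * B i k else 0)"
          by (rule sum.cong) (use insert in \<open>auto simp: u_def\<close>)
        then show "(\<Sum>j\<in>I. u i * B i j * u j) = (if i = k then B k k else 0)"
          using that insert \<open>i \<in> I\<close> by (auto simp: u_def)
      qed simp
      then have "quad_form I B u = B k k" using that insert by simp
      then show "0 \<le> 2 * t * B a k + B k k"
        using insert.prems(2)[of u] by (simp add: ins True ua s)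
    qed
    note z = this
    obtain us where us: "\<forall>i\<in>I. \<forall>j\<in>I. B i j = (\<Sum>u\<leftarrow>us. u i * u j)"
    proof -
      have "0 \<le> quad_form I B u" for u
      proof -
        have "quad_form I B (u(a := 0)) = quad_form I B u"
          by (rule quad_form_cong) (use insert in auto)
        then show ?thesis using insert.prems(2)[of "u(a := 0)"] unfolding ins by simp
      qed
      then show ?thesis using insert.IH[of B] insert.prems(1) that by blast
    qed
    \<comment> \<open>The vectors from the induction hypothesis are arbitrary at \<open>a\<close>,
      so they are reset to \<open>0\<close> there.\<close>
    have "\<forall>i\<in>insert a I. \<forall>j\<in>insert a I. B i j = (\<Sum>u\<leftarrow>map (\<lambda>u. u(a := 0)) us. u i * u j)"
      using us z True insert.prems(1) insert.hyps by (auto simp: o_def intro!: arg_cong[where f = sum_list])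
    then show ?thesis by blast
  next
    case False
    have "0 < B a a"
    proof -
      have "0 \<le> quad_form (insert a I) B (\<lambda>i. if i = a then 1 else 0)" by (rule insert.prems(2))
      also have "\<dots> = B a a"
      proof -
        have "quad_form I B (\<lambda>i. if i = a then 1 else 0) = quad_form I B (\<lambda>i. 0)"
          by (rule quad_form_cong) (use insert in auto)
        moreover have "(\<Sum>j\<in>I. B a j * (if j = a then 1 else 0)) = 0"
          by (rule sum.neutral) (use insert in auto)
        ultimately show ?thesis unfolding ins by (simp add: quad_form_def)
      qed
      finally show ?thesis using False by simp
    qed
    \<comment> \<open>The scaling gives \<open>v v^T\<close> the same row \<open>a\<close> as
      \<open>B\<close>, so that \<open>C\<close> vanishes in this row and is the Schur complement on
      \<open>I\<close>.\<close>
    define v where "v i = B a i / sqrt (B a a)" for i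
    define C where "C i j = B i j - v i * v j" for i j
    have qC: "quad_form I C u = quad_form I B u - (\<Sum>j\<in>I. B a j * u j)\<^sup>2 / B a a" for u
    proof -
      have "v i * v j = B a i * B a j / B a a" for i j
        using \<open>0 < B a a\<close> by (simp add: v_def)
      then show ?thesis
        by (simp add: quad_form_def C_def algebra_simps sum_subtractf power2_eq_square
            sum_product sum_divide_distrib)
    qed
    have "0 \<le> quad_form I C u" for u
    proof -
      define s where "s = (\<Sum>j\<in>I. B a j * u j)"
      \<comment> \<open>This value at \<open>a\<close> minimises the form of \<open>B\<close> in
        that coordinate, and the minimum is the form of the Schur complement at
        \<open>u\<close>.\<close>
      define w where "w = u(a := - s / B a a)"
      have "quad_form I B w = quad_form I B u" "(\<Sum>j\<in>I. B a j * w j) = s"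
        using insert by (auto simp: w_def s_def intro!: quad_form_cong sum.cong)
      then have "quad_form (insert a I) B w =
        B a a * (- s / B a a)\<^sup>2 + 2 * (- s / B a a) * s + quad_form I B u"
        by (simp only: ins) (simp add: w_def)
      also have "\<dots> = quad_form I B u - s\<^sup>2 / B a a"
        using \<open>0 < B a a\<close> by (simp add: power2_eq_square field_simps)
      also have "\<dots> = quad_form I C u" by (simp only: qC s_def)
      finally show ?thesis using insert.prems(2)[of w] by simp
    qed
    moreover have "C i j = C j i" if "i \<in> I" "j \<in> I" for i j
      using insert.prems(1)[of i j] that by (simp add: C_def)
    ultimately obtain us where us: "\<forall>i\<in>I. \<forall>j\<in>I. C i j = (\<Sum>u\<leftarrow>us. u i * u j)"
      using insert.IH[of C] by blast
    have va: "v a * v j = B a j" for j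
      using \<open>0 < B a a\<close> by (simp add: v_def)
    have z: "(\<Sum>u\<leftarrow>us. (u(a := 0)) i * (u(a := 0)) j) = (if i = a \<or> j = a then 0 else (\<Sum>u\<leftarrow>us. u i * u j))" for i j
      by simp
    have "B i j = (\<Sum>u\<leftarrow>v # map (\<lambda>u. u(a := 0)) us. u i * u j)"
      if "i \<in> insert a I" "j \<in> insert a I" for i j
    proof (cases "i = a \<or> j = a")
      case True
      then show ?thesis
        using va[of j] va[of i] insert.prems(1)[OF that] by (auto simp: o_def z mult.commute)
    next
      case False
      then have "C i j = (\<Sum>u\<leftarrow>us. u i * u j)" using us that by blast
      then show ?thesis using False by (simp add: o_def z C_def)
    qed
    then show ?thesis by blast
  qed
qed

text \<open>For each rank one summand, twice \<open>\<bar>u i * u j\<bar>\<close> is at most the sum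
  of two squares, each bounded by the trace.\<close>

lemma psd_entry_bound:
  fixes B :: "nat \<Rightarrow> nat \<Rightarrow> real"
  assumes J: "finite J" and sym: "\<And>i j. i \<in> J \<Longrightarrow> j \<in> J \<Longrightarrow> B i j = B j i"
    and psd: "\<And>u. 0 \<le> quad_form J B u" and ij: "i \<in> J" "j \<in> J"
  shows "\<bar>B i j\<bar> \<le> (\<Sum>k\<in>J. B k k)"
proof -
  obtain us where us: "\<forall>i\<in>J. \<forall>j\<in>J. B i j = (\<Sum>u\<leftarrow>us. u i * u j)"
    using psd_rank_one_decomposition[of J B] assms by blast
  have tr: "(\<Sum>k\<in>J. B k k) = (\<Sum>u\<leftarrow>us. \<Sum>k\<in>J. u k * u k)"
  proof -
    have "(\<Sum>k\<in>J. \<Sum>u\<leftarrow>us. u k * u k) = (\<Sum>u\<leftarrow>us. \<Sum>k\<in>J. u k * u k)"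
      by (induction us) (simp_all add: sum.distrib)
    then show ?thesis using us by simp
  qed
  have *: "\<bar>u i * u j\<bar> \<le> (\<Sum>k\<in>J. u k * u k)" for u :: "nat \<Rightarrow> real"
  proof -
    have le: "u k * u k \<le> (\<Sum>k\<in>J. u k * u k)" if "k \<in> J" for k
      by (rule member_le_sum) (use that J in auto)
    have "2 * \<bar>u i * u j\<bar> \<le> u i * u i + u j * u j"
      using sum_squares_bound[of "\<bar>u i\<bar>" "\<bar>u j\<bar>"] by (simp add: abs_mult power2_eq_square)
    then show ?thesis using le[OF ij(1)] le[OF ij(2)] by linarith
  qed
  have "\<bar>\<Sum>u\<leftarrow>us. u i * u j\<bar> \<le> (\<Sum>u\<leftarrow>us. \<Sum>k\<in>J. u k * u k)" 
    by (induction us) (use * in \<open>auto intro: order_trans[OF abs_triangle_ineq] add_mono\<close>)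
  then show ?thesis using us ij tr by simp
qed

section \<open>The compact convex set of positive semidefinite matrices of trace one\<close>

definition spectraplex :: "nat set \<Rightarrow> (nat \<times> nat \<Rightarrow> real) set" where
  "spectraplex J = {B. (\<forall>p. p \<notin> J \<times> J \<longrightarrow> B p = 0) \<and> (\<forall>i j. B (i, j) = B (j, i)) \<and>
     (\<forall>u. 0 \<le> quad_form J (\<lambda>i j. B (i, j)) u) \<and> (\<Sum>k\<in>J. B (k, k)) = 1}"

text \<open>Matrices are functions of a pair, so the product topology and Tychonoff's theorem apply:
  the set is closed in a cube. The entry bound inside \<open>J \<times> J\<close> and the prescribed
  zeros outside place it there.\<close>

lemma compact_spectraplex:
  assumes "finite J"
  shows "compact (spectraplex J)"
proof -
  let ?Q = "PiE UNIV (\<lambda>_. {-1..1}) :: (nat \<times> nat \<Rightarrow> real) set"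
  have "compactin (product_topology (\<lambda>_. euclidean) UNIV) ?Q"
    by (simp add: compactin_PiE)
  then have "compact ?Q" by (simp add: euclidean_product_topology)
  moreover have "closed (spectraplex J)"
  proof -
    have [continuous_intros]: "continuous_on UNIV (\<lambda>B. B p :: real)" for p :: "nat \<times> nat"
      by simp
    show ?thesis
      unfolding spectraplex_def quad_form_def
      by (intro closed_Collect_conj closed_Collect_all closed_Collect_imp closed_Collect_eq
          closed_Collect_le continuous_intros) auto
  qed
  moreover have "spectraplex J \<subseteq> ?Q"
  proof
    fix B assume B: "B \<in> spectraplex J"
    have "\<bar>B (i, j)\<bar> \<le> 1" for i j
    proof (cases "i \<in> J \<and> j \<in> J")
      case True
      then show ?thesis
        using psd_entry_bound[of J "\<lambda>i j. B (i, j)" i j] B assms by (auto simp: spectraplex_def)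
    next
      case False
      then show ?thesis using B by (auto simp: spectraplex_def)
    qed
    then show "B \<in> ?Q" by (force simp: PiE_iff abs_le_iff)
  qed
  ultimately show ?thesis by (metis compact_Int_closed inf.absorb_iff2)
qed

lemma convex_spectraplex:
  assumes "B \<in> spectraplex J" "C \<in> spectraplex J" "0 \<le> e" "e \<le> 1"
  shows "(\<lambda>p. (1 - e) * B p + e * C p) \<in> spectraplex J"
proof -
  have "quad_form J (\<lambda>i j. (1 - e) * B (i, j) + e * C (i, j)) u =
    (1 - e) * quad_form J (\<lambda>i j. B (i, j)) u + e * quad_form J (\<lambda>i j. C (i, j)) u" for u
    by (simp add: quad_form_def sum.distrib sum_distrib_left distrib_left distrib_right mult_ac
        del: sum.delta)
  moreover have "(\<Sum>k\<in>J. (1 - e) * B (k, k) + e * C (k, k)) =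
    (1 - e) * (\<Sum>k\<in>J. B (k, k)) + e * (\<Sum>k\<in>J. C (k, k))"
    by (simp add: sum.distrib sum_distrib_left)
  ultimately show ?thesis using assms by (simp add: spectraplex_def)
qed

text \<open>The normalised matrices \<open>u u^T\<close> are the test points that turn a separating
  functional into a statement about quadratic forms.\<close>

lemma rank_one_in_spectraplex:
  assumes J: "finite J" and k: "k \<in> J" "u k \<noteq> 0"
  defines "N \<equiv> \<Sum>k\<in>J. (u k)\<^sup>2"
  shows "N > 0" "(\<lambda>(i, j). if i \<in> J \<and> j \<in> J then u i * u j / N else 0) \<in> spectraplex J"
proof -
  show N: "N > 0"
    unfolding N_def by (rule sum_pos2[OF J k(1)]) (use k in auto)
  have "quad_form J (\<lambda>i j. case (i, j) of (i, j) \<Rightarrow> if i \<in> J \<and> j \<in> J then u i * u j / N else 0) w =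
    (\<Sum>i\<in>J. u i * w i)\<^sup>2 / N" for w
    by (simp add: quad_form_def power2_eq_square sum_product sum_divide_distrib mult_ac)
  moreover have "(\<Sum>k\<in>J. u k * u k / N) = 1"
    using N by (simp add: N_def power2_eq_square flip: sum_divide_distrib)
  ultimately show "(\<lambda>(i, j). if i \<in> J \<and> j \<in> J then u i * u j / N else 0) \<in> spectraplex J"
    using N by (auto simp: spectraplex_def)
qed

text \<open>The first order condition at a minimum on a segment: after division by \<open>e\<close>,
  a small \<open>e\<close> leaves the sign of \<open>D\<close>.\<close>

lemma nonneg_of_quadratic_perturbation:
  fixes D E :: real
  assumes "0 \<le> E" "\<And>e. 0 < e \<Longrightarrow> e \<le> 1 \<Longrightarrow> 0 \<le> 2 * e * D + e\<^sup>2 * E"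
  shows "0 \<le> D"
proof (rule ccontr)
  assume D: "\<not> 0 \<le> D"
  define e where "e = min 1 (- D / (E + 1))"
  have e: "0 < e" "e \<le> 1" "e \<le> - D / (E + 1)"
    using D assms(1) by (auto simp: e_def divide_neg_pos)
  have "0 \<le> e * (2 * D + e * E)" using assms(2)[OF e(1,2)] by (simp add: power2_eq_square algebra_simps)
  then have "0 \<le> 2 * D + e * E" using e(1) by (simp add: zero_le_mult_iff)
  moreover have "e * (E + 1) \<le> - D" using e(3) assms(1) by (simp add: field_simps)
  ultimately show False using e(1) D by (simp add: algebra_simps)
qed

text \<open>Either the image of the spectraplex under \<open>B \<mapsto> (\<langle>G f, B\<rangle>)\<^sub>f\<close> contains the origin, or its
  point closest to the origin is the normal of a separating hyperplane.\<close>

lemma psd_alternative: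
  fixes G :: "'f \<Rightarrow> nat \<Rightarrow> nat \<Rightarrow> real"
  assumes J: "finite J" and F: "finite F"
  obtains (separation) y where "\<And>u k. k \<in> J \<Longrightarrow> u k \<noteq> 0 \<Longrightarrow> 0 < (\<Sum>f\<in>F. y f * quad_form J (G f) u)"
  | (dependence) us u k where "u \<in> set us" "k \<in> J" "u k \<noteq> 0"
      "\<And>f. f \<in> F \<Longrightarrow> (\<Sum>u\<leftarrow>us. quad_form J (G f) u) = 0"
proof (cases "J = {}")
  case True
  then show ?thesis using separation by blast
next
  case False
  \<comment> \<open>\<open>pr B f\<close> is the pairing of \<open>G f\<close> with
    \<open>B\<close>. Below, the squared length of the vector of these pairings is minimised over
    the spectraplex.\<close>
  define pr where "pr B f = (\<Sum>i\<in>J. \<Sum>j\<in>J. G f i j * B (i, j))" for f B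
  have "spectraplex J \<noteq> {}"
    using rank_one_in_spectraplex(2)[OF J, of _ "\<lambda>_. 1"] False by auto
  moreover have "continuous_on (spectraplex J) (\<lambda>B. \<Sum>f\<in>F. (pr B f)\<^sup>2)"
    unfolding pr_def
    by (intro continuous_intros continuous_on_subset[OF continuous_on_product_coordinates]) auto
  ultimately obtain B where B: "B \<in> spectraplex J"
    and min: "\<And>C. C \<in> spectraplex J \<Longrightarrow> (\<Sum>f\<in>F. (pr B f)\<^sup>2) \<le> (\<Sum>f\<in>F. (pr C f)\<^sup>2)"
    using continuous_attains_inf[OF compact_spectraplex[OF J]] by blast
  show ?thesis
  proof (cases "\<forall>f\<in>F. pr B f = 0")
    case True
    obtain us where us: "\<forall>i\<in>J. \<forall>j\<in>J. B (i, j) = (\<Sum>u\<leftarrow>us. u i * u j)"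
      using psd_rank_one_decomposition[OF J, of "\<lambda>i j. B (i, j)"] B by (auto simp: spectraplex_def)
    \<comment> \<open>Trace one prevents all vectors of the decomposition from vanishing on
      \<open>J\<close>.\<close>
    have "\<exists>u\<in>set us. \<exists>k\<in>J. u k \<noteq> 0"
    proof (rule ccontr)
      assume "\<not> ?thesis"
      then have "map (\<lambda>u. u k * u k) us = map (\<lambda>_. 0) us" if "k \<in> J" for k
        using that by simp
      then have "\<forall>k\<in>J. (\<Sum>u\<leftarrow>us. u k * u k) = 0" by (simp del: map_eq_conv)
      then have "(\<Sum>k\<in>J. B (k, k)) = 0" using us by simp
      then show False using B by (simp add: spectraplex_def)
    qed
    then obtain u k where uk: "u \<in> set us" "k \<in> J" "u k \<noteq> 0" by blast
    have "(\<Sum>u\<leftarrow>us. quad_form J (G f) u) = pr B f" for f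
    proof -
      have "(\<Sum>u\<leftarrow>us. quad_form J (G f) u) = (\<Sum>i\<in>J. \<Sum>j\<in>J. G f i j * (\<Sum>u\<leftarrow>us. u i * u j))"
        by (induction us) (simp_all add: quad_form_def sum.distrib algebra_simps)
      then show ?thesis using us by (simp add: pr_def)
    qed
    then show ?thesis using dependence[OF uk] True by simp
  next
    case F0: False
    have "0 < (\<Sum>f\<in>F. pr B f * quad_form J (G f) u)" if k: "k \<in> J" "u k \<noteq> 0" for u k
    proof -
      define N where "N = (\<Sum>k\<in>J. (u k)\<^sup>2)"
      define C where "C = (\<lambda>(i, j). if i \<in> J \<and> j \<in> J then u i * u j / N else 0)"
      have N: "0 < N" and C: "C \<in> spectraplex J"
        using rank_one_in_spectraplex[OF J, of k u] k unfolding N_def C_def by blast+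
      have prC: "pr C f = quad_form J (G f) u / N" for f
        by (simp add: pr_def C_def quad_form_def sum_divide_distrib mult_ac)
      \<comment> \<open>\<open>D\<close> is half the derivative of the squared distance at
        \<open>B\<close> towards \<open>C\<close>. Minimality makes it nonnegative, so the inner
        product of the images of \<open>B\<close> and \<open>C\<close> is at least the squared
        length of the image of \<open>B\<close>.\<close>
      define D where "D = (\<Sum>f\<in>F. pr B f * (pr C f - pr B f))"
      have "0 \<le> D"
      proof (rule nonneg_of_quadratic_perturbation)
        show "0 \<le> (\<Sum>f\<in>F. (pr C f - pr B f)\<^sup>2)" by (simp add: sum_nonneg)
        fix e :: real assume e: "0 < e" "e \<le> 1"
        let ?M = "\<lambda>p. (1 - e) * B p + e * C p"
        have "pr ?M f = pr B f + e * (pr C f - pr B f)" for f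
          by (simp add: pr_def algebra_simps sum.distrib sum_subtractf sum_distrib_left)
        then have "(pr ?M f)\<^sup>2 = (pr B f)\<^sup>2 + 2 * e * (pr B f * (pr C f - pr B f)) +
          e\<^sup>2 * (pr C f - pr B f)\<^sup>2" for f
          by (simp only:) (simp add: power2_eq_square algebra_simps)
        then have "(\<Sum>f\<in>F. (pr ?M f)\<^sup>2) =
          (\<Sum>f\<in>F. (pr B f)\<^sup>2) + 2 * e * D + e\<^sup>2 * (\<Sum>f\<in>F. (pr C f - pr B f)\<^sup>2)"
          by (simp only: D_def sum.distrib sum_distrib_left)
        then show "0 \<le> 2 * e * D + e\<^sup>2 * (\<Sum>f\<in>F. (pr C f - pr B f)\<^sup>2)"
          using min[OF convex_spectraplex[OF B C, of e]] e by simp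
      qed
      moreover have "0 < (\<Sum>f\<in>F. (pr B f)\<^sup>2)"
        using F0 F by (auto intro: sum_pos2)
      moreover have "D = (\<Sum>f\<in>F. pr B f * quad_form J (G f) u) / N - (\<Sum>f\<in>F. (pr B f)\<^sup>2)"
        by (simp add: D_def prC right_diff_distrib sum_subtractf sum_divide_distrib power2_eq_square)
      ultimately have "0 < (\<Sum>f\<in>F. pr B f * quad_form J (G f) u) / N" by linarith
      then show ?thesis using N by (simp add: zero_less_divide_iff)
    qed
    then show ?thesis by (rule separation)
  qed
qed

section \<open>Polynomials and linear functionals\<close>

abbreviation const :: "real \<Rightarrow> mpoly" where
  "const c \<equiv> Poly_Mapping.single 0 c"

abbreviation var :: "nat \<Rightarrow> mpoly" where
  "var i \<equiv> Poly_Mapping.single (Poly_Mapping.single i 1) 1"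

text \<open>Scalars act through constant polynomials, which makes spans, subspaces and bases
  available for sets of polynomials.\<close>

interpretation mp: vector_space "\<lambda>c p. const c * p"
  by standard (simp_all add: algebra_simps single_add mult_single)

section \<open>Degree bounds and affine polynomials\<close>

definition monom_degree :: "(nat \<Rightarrow>\<^sub>0 nat) \<Rightarrow> nat" where
  "monom_degree m = (\<Sum>i\<in>Poly_Mapping.keys m. Poly_Mapping.lookup m i)"

lemma monom_degree_superset:
  "finite S \<Longrightarrow> Poly_Mapping.keys m \<subseteq> S \<Longrightarrow> monom_degree m = (\<Sum>i\<in>S. Poly_Mapping.lookup m i)"
  unfolding monom_degree_def by (rule sum.mono_neutral_left) (auto simp: in_keys_iff)

lemma monom_degree_add: "monom_degree (a + b) = monom_degree a + monom_degree b"
proof -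
  let ?S = "Poly_Mapping.keys a \<union> Poly_Mapping.keys b"
  have "monom_degree m = (\<Sum>i\<in>?S. Poly_Mapping.lookup m i)" if "m \<in> {a, b, a + b}" for m
    by (rule monom_degree_superset) (use that keys_add[of a b] in auto)
  then show ?thesis by (simp add: lookup_add sum.distrib)
qed

lemma polys_le_iff:
  "p \<in> polys_le n k \<longleftrightarrow>
    (\<forall>m\<in>Poly_Mapping.keys p. Poly_Mapping.keys m \<subseteq> {..<n} \<and> monom_degree m \<le> k)"
  by (auto simp: polys_le_def polys_def total_degree_def monom_degree_def)

lemma polys_le_const: "const c \<in> polys_le n k"
  by (simp add: polys_le_iff monom_degree_def)

lemma polys_le_0: "0 \<in> polys_le n k"
  by (simp add: polys_le_iff)

lemma polys_le_1: "1 \<in> polys_le n k"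
  using polys_le_const[of 1] by simp

lemma polys_le_mono: "p \<in> polys_le n k \<Longrightarrow> k \<le> l \<Longrightarrow> p \<in> polys_le n l"
  by (force simp: polys_le_iff)

lemma polys_le_add: "p \<in> polys_le n k \<Longrightarrow> q \<in> polys_le n k \<Longrightarrow> p + q \<in> polys_le n k"
  using keys_add[of p q] by (fastforce simp: polys_le_iff)

lemma polys_le_uminus: "p \<in> polys_le n k \<Longrightarrow> - p \<in> polys_le n k"
  by (simp add: polys_le_iff in_keys_iff)

lemma polys_le_diff: "p \<in> polys_le n k \<Longrightarrow> q \<in> polys_le n k \<Longrightarrow> p - q \<in> polys_le n k"
  using polys_le_add[OF _ polys_le_uminus, of p n k q] by simp

lemma polys_le_mult:
  assumes p: "p \<in> polys_le n k" and q: "q \<in> polys_le n l"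
  shows "p * q \<in> polys_le n (k + l)"
  unfolding polys_le_iff
proof
  fix m assume "m \<in> Poly_Mapping.keys (p * q)"
  then obtain a b where "a \<in> Poly_Mapping.keys p" "b \<in> Poly_Mapping.keys q" "m = a + b"
    using keys_mult[of p q] by blast
  then show "Poly_Mapping.keys m \<subseteq> {..<n} \<and> monom_degree m \<le> k + l"
    using p q keys_add[of a b] by (fastforce simp: polys_le_iff monom_degree_add intro: add_mono)
qed

lemma polys_le_sum: "(\<And>i. i \<in> S \<Longrightarrow> f i \<in> polys_le n k) \<Longrightarrow> sum f S \<in> polys_le n k"
  by (induction S rule: infinite_finite_induct) (auto intro: polys_le_0 polys_le_add)

lemma polys_le_scale: "p \<in> polys_le n k \<Longrightarrow> const c * p \<in> polys_le n k"
  using polys_le_mult[OF polys_le_const, of p n k c 0] by simp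

lemma degree_le_1_monom:
  assumes "Poly_Mapping.keys m \<subseteq> {..<n}" "monom_degree m \<le> 1"
  obtains "m = 0" | i where "i < n" "m = Poly_Mapping.single i 1"
proof (cases "m = 0")
  case False
  then obtain i where i: "i \<in> Poly_Mapping.keys m" by fastforce
  have "monom_degree m = Poly_Mapping.lookup m i + (\<Sum>j\<in>Poly_Mapping.keys m - {i}. Poly_Mapping.lookup m j)"
    unfolding monom_degree_def using i by (simp add: sum.remove)
  moreover have "Poly_Mapping.lookup m i \<noteq> 0" using i by (simp add: in_keys_iff)
  ultimately have one: "Poly_Mapping.lookup m i = 1"
    and "(\<Sum>j\<in>Poly_Mapping.keys m - {i}. Poly_Mapping.lookup m j) = 0"
    using assms(2) by linarith+
  then have "\<forall>j\<in>Poly_Mapping.keys m - {i}. Poly_Mapping.lookup m j = 0"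
    by (subst (asm) sum_eq_0_iff) simp_all
  then have "Poly_Mapping.lookup m j = 0" if "j \<noteq> i" for j
    using that by (cases "j \<in> Poly_Mapping.keys m") (blast, simp add: in_keys_iff)
  then have "m = Poly_Mapping.single i 1"
    using one by (intro poly_mapping_eqI) (auto simp: lookup_single when_def)
  then show ?thesis using that(2) assms(1) i by blast
qed (use that in blast)

lemma sum_monomials:
  "(\<Sum>m\<in>Poly_Mapping.keys p. const (Poly_Mapping.lookup p m) * Poly_Mapping.single m 1) = p"
proof (rule poly_mapping_eqI)
  fix k
  have "Poly_Mapping.lookup (\<Sum>m\<in>Poly_Mapping.keys p.
      const (Poly_Mapping.lookup p m) * Poly_Mapping.single m 1) k =
    (\<Sum>m\<in>Poly_Mapping.keys p. if m = k then Poly_Mapping.lookup p m else 0)"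
    by (simp add: lookup_sum mult_single lookup_single when_def)
  also have "\<dots> = Poly_Mapping.lookup p k"
    by (simp add: in_keys_iff)
  finally show "Poly_Mapping.lookup (\<Sum>m\<in>Poly_Mapping.keys p.
      const (Poly_Mapping.lookup p m) * Poly_Mapping.single m 1) k = Poly_Mapping.lookup p k" .
qed

lemma affine_in_span:
  assumes "p \<in> polys_le n 1"
  shows "p \<in> mp.span (insert 1 (var ` {..<n}))"
proof -
  have "const (Poly_Mapping.lookup p m) * Poly_Mapping.single m 1 \<in> mp.span (insert 1 (var ` {..<n}))"
    if "m \<in> Poly_Mapping.keys p" for m
  proof (rule mp.span_scale, rule mp.span_base)
    have "Poly_Mapping.keys m \<subseteq> {..<n}" "monom_degree m \<le> 1"
      using assms that by (auto simp: polys_le_iff)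
    then show "Poly_Mapping.single m 1 \<in> insert 1 (var ` {..<n})"
      by (cases rule: degree_le_1_monom) auto
  qed
  then have "(\<Sum>m\<in>Poly_Mapping.keys p. const (Poly_Mapping.lookup p m) * Poly_Mapping.single m 1)
      \<in> mp.span (insert 1 (var ` {..<n}))"
    by (rule mp.span_sum)
  then show ?thesis by (simp only: sum_monomials)
qed

section \<open>Linear functionals, point evaluations and separation from a subspace\<close>

definition linear_fun :: "(mpoly \<Rightarrow> real) \<Rightarrow> bool" where
  "linear_fun f \<longleftrightarrow> (\<forall>p q. f (p + q) = f p + f q) \<and> (\<forall>c p. f (const c * p) = c * f p)"

lemma linear_funD:
  assumes "linear_fun f"
  shows "f (p + q) = f p + f q" "f (const c * p) = c * f p" "f 0 = 0"
    "f (- p) = - f p" "f (p - q) = f p - f q"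
proof -
  show *: "f (p + q) = f p + f q" "f (const c * p) = c * f p" for p q c
    using assms by (auto simp: linear_fun_def)
  show "f 0 = 0" using *(2)[of 0 0] by simp
  show m: "f (- p) = - f p" for p using *(2)[of "-1" p] by (simp add: single_uminus)
  show "f (p - q) = f p - f q" using *(1)[of p "- q"] m[of q] by simp
qed

lemma linear_fun_sum:
  assumes "linear_fun f"
  shows "f (sum g S) = (\<Sum>i\<in>S. f (g i))"
  by (induction S rule: infinite_finite_induct) (simp_all add: linear_funD[OF assms])

lemma linear_fun_sum_list:
  assumes "linear_fun f"
  shows "f (\<Sum>x\<leftarrow>xs. g x) = (\<Sum>x\<leftarrow>xs. f (g x))"
  by (induction xs) (simp_all add: linear_funD[OF assms])

lemma linear_fun_const: "linear_fun f \<Longrightarrow> f (const c) = c * f 1"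
  using linear_funD(2)[of f c 1] by simp

lemma linear_fun_combination:
  assumes "\<And>f. f \<in> F \<Longrightarrow> linear_fun f"
  shows "linear_fun (\<lambda>v. \<Sum>f\<in>F. y f * f v)"
proof -
  have "(\<Sum>f\<in>F. y f * f (p + q)) = (\<Sum>f\<in>F. y f * f p + y f * f q)" for p q
    by (rule sum.cong, rule refl) (use assms in \<open>metis linear_funD(1) distrib_left\<close>)
  moreover have "(\<Sum>f\<in>F. y f * f (const c * p)) = (\<Sum>f\<in>F. c * (y f * f p))" for c p
    by (rule sum.cong, rule refl) (use assms in \<open>metis linear_funD(2) mult.left_commute\<close>)
  ultimately show ?thesis by (simp add: linear_fun_def sum.distrib sum_distrib_left)
qed

lemma linear_fun_divide:
  assumes "linear_fun f"
  shows "linear_fun (\<lambda>v. f v / c)"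
  unfolding linear_fun_def by (simp add: linear_funD[OF assms] add_divide_distrib)

lemma const_quad_form:
  "quad_form I a (\<lambda>i. const (u i)) = (\<Sum>i\<in>I. \<Sum>j\<in>I. const (u i * u j) * a i j)"
  by (simp add: quad_form_def mult_single[of 0 _ 0, simplified, symmetric] mult_ac)

lemma linear_fun_quad_form:
  assumes "linear_fun f"
  shows "f (quad_form I a (\<lambda>i. const (u i))) = quad_form I (\<lambda>i j. f (a i j)) u"
  by (simp add: const_quad_form linear_fun_sum[OF assms] linear_funD[OF assms])
    (simp add: quad_form_def mult_ac)

text \<open>An affine polynomial is a combination of \<open>1\<close> and the variables, so
  \<open>f\<close> acts on it as evaluation at the point with coordinates
  \<open>f (var i)\<close>.\<close>

lemma poly_eval_affine:
  assumes f: "linear_fun f" "f 1 = 1" and p: "p \<in> polys_le n 1"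
  shows "poly_eval (vec n (\<lambda>i. f (var i))) p = f p"
proof -
  have "(\<Prod>i\<in>Poly_Mapping.keys m. (vec n (\<lambda>i. f (var i)) $ i) ^ Poly_Mapping.lookup m i) =
    f (Poly_Mapping.single m 1)" if "m \<in> Poly_Mapping.keys p" for m
  proof -
    have "Poly_Mapping.keys m \<subseteq> {..<n}" "monom_degree m \<le> 1"
      using p that by (auto simp: polys_le_iff)
    then show ?thesis by (cases rule: degree_le_1_monom) (auto simp: f(2))
  qed
  then have "poly_eval (vec n (\<lambda>i. f (var i))) p =
    f (\<Sum>m\<in>Poly_Mapping.keys p. const (Poly_Mapping.lookup p m) * Poly_Mapping.single m 1)"
    by (simp add: poly_eval_def linear_fun_sum[OF f(1)] linear_funD[OF f(1)])
  then show ?thesis by (simp add: sum_monomials)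
qed

text \<open>A basis of \<open>L\<close> is extended to all polynomials. The coordinates at the added
  basis elements vanish on \<open>L\<close>, and together they detect membership in
  \<open>L\<close>.\<close>

lemma separating_functionals:
  assumes L: "mp.subspace L" and S: "finite S"
  obtains F where "finite F" "\<forall>f\<in>F. linear_fun f" "\<forall>f\<in>F. \<forall>v\<in>L. f v = 0"
    "\<forall>v\<in>mp.span S. (\<forall>f\<in>F. f v = 0) \<longrightarrow> v \<in> L"
proof -
  obtain B where B: "B \<subseteq> L" "mp.independent B" "L \<subseteq> mp.span B"
    using mp.maximal_independent_subset[of L] by blast
  define E where "E = mp.extend_basis B"
  have E: "mp.independent E" "mp.span E = UNIV" "B \<subseteq> E"
    using B(2) by (auto simp: E_def mp.independent_extend_basis mp.span_extend_basis mp.extend_basis_superset)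
  let ?R = "mp.representation E"
  have lin: "linear_fun (\<lambda>v. ?R v b)" for b
    by (simp add: linear_fun_def mp.representation_add mp.representation_scale E)
  \<comment> \<open>On the span of \<open>S\<close> finitely many coordinates suffice: those outside
    \<open>B\<close> that occur in an element of \<open>S\<close>.\<close>
  define K where "K = (\<Union>v\<in>S. {b. ?R v b \<noteq> 0}) - B"
  show ?thesis
  proof (rule that[of "(\<lambda>b v. ?R v b) ` K"]; (intro ballI impI)?)
    show "finite ((\<lambda>b v. ?R v b) ` K)"
      using S by (auto simp: K_def mp.finite_representation)
    show "linear_fun f" if "f \<in> (\<lambda>b v. ?R v b) ` K" for f
      using that lin by blast
    show "f v = 0" if f: "f \<in> (\<lambda>b v. ?R v b) ` K" and "v \<in> L" for f v
    proof -
      have "?R v = mp.representation B v"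
        using E B that by (intro mp.representation_extend) auto
      moreover obtain b where "b \<notin> B" "f = (\<lambda>v. ?R v b)" using f by (auto simp: K_def)
      ultimately show ?thesis using mp.representation_ne_zero[of B v b] by auto
    qed
    fix v assume v: "v \<in> mp.span S" and 0: "\<forall>f\<in>(\<lambda>b v. ?R v b) ` K. f v = 0"
    have in_B: "b \<in> B" if "?R v b \<noteq> 0" for b
    proof (rule ccontr)
      assume "b \<notin> B"
      show False
      proof (cases "b \<in> K")
        case True
        then show False using bspec[OF 0 imageI[OF True]] that by simp
      next
        case False
        then have "S \<subseteq> {v. ?R v b = 0}" using \<open>b \<notin> B\<close> by (auto simp: K_def)
        moreover have "mp.subspace {v. ?R v b = 0}"
          by (simp add: mp.subspace_def linear_funD[OF lin])
        ultimately have "v \<in> {v. ?R v b = 0}" using v mp.span_minimal by blast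
        then show False using that by simp
      qed
    qed
    have "(\<Sum>b | ?R v b \<noteq> 0. const (?R v b) * b) \<in> mp.span B"
      by (intro mp.span_sum mp.span_scale mp.span_base) (use in_B in auto)
    then have "v \<in> mp.span B"
      using mp.sum_nonzero_representation_eq[of E v] E by simp
    then show "v \<in> L" using B(1) L mp.span_minimal by blast
  qed
qed

text \<open>On affine polynomials, the linear functionals \<open>f\<close> with \<open>f 1 = 1\<close> are exactly the point
  evaluations, so this says that the submatrix indexed by \<open>I\<close> is nowhere positive semidefinite on
  the zero set of \<open>L\<close>.\<close>

definition pencil_infeasible :: "mpoly set \<Rightarrow> nat set \<Rightarrow> (nat \<Rightarrow> nat \<Rightarrow> mpoly) \<Rightarrow> bool" where
  "pencil_infeasible L I a \<longleftrightarrow> (\<forall>f. linear_fun f \<and> f 1 = 1 \<and> (\<forall>v\<in>L. f v = 0) \<longrightarrow>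
     (\<exists>u. quad_form I (\<lambda>i j. f (a i j)) u < 0))"

text \<open>The matrix alternative is applied to the pencil bordered by a diagonal entry
  \<open>1\<close>. A separating functional, normalised at \<open>1\<close>, would make the
  submatrix positive definite and contradict infeasibility; a dependence is the required element of
  \<open>L\<close>.\<close>

lemma pencil_alternative:
  assumes L: "mp.subspace L" and I: "finite I"
    and infeas: "pencil_infeasible L I a"
  obtains us c where "(\<Sum>u\<leftarrow>us. quad_form I a (\<lambda>i. const (u i))) + const c \<in> L" "0 \<le> c"
    "0 < c \<or> (\<exists>u\<in>set us. \<exists>k\<in>I. u k \<noteq> 0)"
proof -
  \<comment> \<open>The fresh index \<open>z\<close> carries the diagonal entry \<open>1\<close>;
    the squares of the coordinates at \<open>z\<close> will add up to \<open>c\<close>.\<close>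
  obtain z where z: "z \<notin> I" using I ex_new_if_finite[of I] by auto
  define S where "S = insert 1 ((\<lambda>(i, j). a i j) ` (I \<times> I))"
  have "finite S" using I by (simp add: S_def)
  then obtain F where F: "finite F" and lin': "\<forall>f\<in>F. linear_fun f"
    and van: "\<forall>f\<in>F. \<forall>v\<in>L. f v = 0" and sep: "\<forall>v\<in>mp.span S. (\<forall>f\<in>F. f v = 0) \<longrightarrow> v \<in> L"
    by (rule separating_functionals[OF L])
  note lin = bspec[OF lin']
  define G where "G f i j = (if i = z \<and> j = z then f 1 else if i = z \<or> j = z then 0 else f (a i j))"
    for f :: "mpoly \<Rightarrow> real" and i j
  have qG: "quad_form (insert z I) (G f) u = f 1 * (u z)\<^sup>2 + quad_form I (\<lambda>i j. f (a i j)) u" for f u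
  proof -
    have "quad_form I (G f) u = quad_form I (\<lambda>i j. f (a i j)) u"
      by (rule quad_form_cong) (use z in \<open>auto simp: G_def\<close>)
    moreover have "(\<Sum>j\<in>I. G f z j * u j) = 0"
      by (rule sum.neutral) (use z in \<open>auto simp: G_def\<close>)
    moreover have "G f z z = f 1" by (simp add: G_def)
    ultimately show ?thesis using z I by (subst quad_form_insert) (auto simp: G_def)
  qed
  have J: "finite (insert z I)" using I by simp
  from J F show ?thesis
  proof (cases rule: psd_alternative[where G = G])
    case (separation y)
    define p where "p v = (\<Sum>f\<in>F. y f * f v)" for v
    have p: "linear_fun p" unfolding p_def by (rule linear_fun_combination) (rule lin)
    have pos: "0 < p 1 * (u z)\<^sup>2 + quad_form I (\<lambda>i j. p (a i j)) u"
      if "k \<in> insert z I" "u k \<noteq> 0" for u k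
    proof -
      have "quad_form I (\<lambda>i j. p (a i j)) u = p (quad_form I a (\<lambda>i. const (u i)))"
        by (rule linear_fun_quad_form[OF p, symmetric])
      also have "\<dots> = (\<Sum>f\<in>F. y f * quad_form I (\<lambda>i j. f (a i j)) u)"
        unfolding p_def
      proof (rule sum.cong)
        fix f assume "f \<in> F"
        show "y f * f (quad_form I a (\<lambda>i. const (u i))) = y f * quad_form I (\<lambda>i j. f (a i j)) u"
          by (simp only: linear_fun_quad_form[OF lin[OF \<open>f \<in> F\<close>]])
      qed (rule refl)
      finally have "p 1 * (u z)\<^sup>2 + quad_form I (\<lambda>i j. p (a i j)) u =
        (\<Sum>f\<in>F. y f * quad_form (insert z I) (G f) u)"
        by (simp only: qG p_def distrib_left sum.distrib sum_distrib_right mult.assoc)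
      then show ?thesis
        using separation[of k u, OF that] by (simp only:)
    qed
    \<comment> \<open>The unit vector at \<open>z\<close> yields \<open>p 1 > 0\<close>, so
      \<open>p\<close> can be divided by \<open>p 1\<close>.\<close>
    have "quad_form I (\<lambda>i j. p (a i j)) (\<lambda>i. if i = z then 1 else 0) = quad_form I (\<lambda>i j. p (a i j)) (\<lambda>i. 0)"
      by (rule quad_form_cong) (use z in auto)
    then have p1: "0 < p 1"
      using pos[of z "\<lambda>i. if i = z then 1 else 0"] by (simp add: quad_form_def)
    have "p v = 0" if "v \<in> L" for v
      unfolding p_def
    proof (intro sum.neutral ballI)
      fix f assume "f \<in> F"
      then have "f v = 0" using van that by blast
      then show "y f * f v = 0" by simp
    qed
    then have "linear_fun (\<lambda>v. p v / p 1) \<and> p 1 / p 1 = 1 \<and> (\<forall>v\<in>L. p v / p 1 = 0)"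
      using p1 linear_fun_divide[OF p] by simp
    then obtain u where "quad_form I (\<lambda>i j. p (a i j) / p 1) u < 0"
      using infeas[unfolded pencil_infeasible_def, THEN spec[of _ "\<lambda>v. p v / p 1"]] by auto
    moreover have "quad_form I (\<lambda>i j. p (a i j) / p 1) u = quad_form I (\<lambda>i j. p (a i j)) u / p 1"
      by (simp add: quad_form_def sum_divide_distrib)
    ultimately have neg: "quad_form I (\<lambda>i j. p (a i j)) u < 0"
      using p1 by (simp add: divide_less_0_iff)
    \<comment> \<open>Resetting the coordinate at \<open>z\<close> keeps the form on
      \<open>I\<close> and removes the summand \<open>p 1 * (u z)\<^sup>2\<close> from
      \<open>pos\<close>.\<close>
    have e: "quad_form I (\<lambda>i j. p (a i j)) (u(z := 0)) = quad_form I (\<lambda>i j. p (a i j)) u"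
      by (rule quad_form_cong) (use z in auto)
    have "\<exists>k\<in>I. u k \<noteq> 0"
    proof (rule ccontr)
      assume "\<not> ?thesis"
      then have "quad_form I (\<lambda>i j. p (a i j)) u = 0" by (simp add: quad_form_def)
      then show False using neg by simp
    qed
    then obtain k where "k \<in> I" "u k \<noteq> 0" by blast
    then have False using pos[of k "u(z := 0)"] neg e z by (cases "k = z") auto
    then show ?thesis ..
  next
    case (dependence us w k)
    define c where "c = (\<Sum>u\<leftarrow>us. (u z)\<^sup>2)"
    define v where "v = (\<Sum>u\<leftarrow>us. quad_form I a (\<lambda>i. const (u i))) + const c"
    have "f v = 0" if "f \<in> F" for f
    proof -
      note f = lin[OF that]
      have "f v = (\<Sum>u\<leftarrow>us. quad_form I (\<lambda>i j. f (a i j)) u) + c * f 1"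
        by (simp only: v_def linear_funD(1)[OF f] linear_fun_sum_list[OF f] linear_fun_quad_form[OF f]
            linear_fun_const[OF f])
      also have "\<dots> = (\<Sum>u\<leftarrow>us. quad_form (insert z I) (G f) u)"
        by (simp add: qG c_def sum_list_addf sum_list_const_mult)
      finally have "f v = (\<Sum>u\<leftarrow>us. quad_form (insert z I) (G f) u)" .
      then show ?thesis using dependence(4)[OF that] by simp
    qed
    moreover have "v \<in> mp.span S"
    proof -
      have "quad_form I a (\<lambda>i. const (u i)) \<in> mp.span S" for u
        unfolding const_quad_form
        by (intro mp.span_sum mp.span_scale mp.span_base) (auto simp: S_def)
      then have "(\<Sum>u\<leftarrow>us. quad_form I a (\<lambda>i. const (u i))) \<in> mp.span S"
        by (induction us) (auto intro: mp.span_zero mp.span_add)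
      moreover have "const c \<in> mp.span S"
        using mp.span_scale[OF mp.span_base[of 1 S], of c] by (simp add: S_def)
      ultimately show ?thesis unfolding v_def by (rule mp.span_add)
    qed
    ultimately have "v \<in> L" using sep by blast
    moreover have "0 \<le> c" unfolding c_def by (rule sum_list_nonneg) auto
    \<comment> \<open>The nonzero coordinate lies either at \<open>z\<close>, which makes
      \<open>c\<close> positive, or in \<open>I\<close>.\<close>
    moreover have "0 < c" if "k = z"
    proof -
      have "(w z)\<^sup>2 \<le> c" unfolding c_def
        by (rule member_le_sum_list) (use dependence(1) in auto)
      moreover have "0 < (w z)\<^sup>2" using dependence(3) that by simp
      ultimately show ?thesis by linarith
    qed
    ultimately show ?thesis using that[of us c] dependence(1-3) by (auto simp: v_def)
  qed
qed

section \<open>Certificates\<close>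

text \<open>The truncated quadratic module of the principal submatrix with index set \<open>I\<close>, relative to the
  affine subspace on which the affine polynomials in \<open>L\<close> vanish.\<close>

inductive_set qmod :: "nat \<Rightarrow> (nat \<Rightarrow> nat \<Rightarrow> mpoly) \<Rightarrow> nat set \<Rightarrow> mpoly set \<Rightarrow> nat \<Rightarrow> mpoly set"
  for n a I L k where
  qmod_0: "0 \<in> qmod n a I L k"
| qmod_square: "p \<in> polys_le n k \<Longrightarrow> s \<in> qmod n a I L k \<Longrightarrow> p\<^sup>2 + s \<in> qmod n a I L k"
| qmod_form: "\<forall>i\<in>I. v i \<in> polys_le n k \<Longrightarrow> s \<in> qmod n a I L k \<Longrightarrow> quad_form I a v + s \<in> qmod n a I L k"
| qmod_lin: "l \<in> L \<Longrightarrow> q \<in> polys_le n (2 * k) \<Longrightarrow> s \<in> qmod n a I L k \<Longrightarrow> l * q + s \<in> qmod n a I L k"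

lemma qmod_add: "s \<in> qmod n a I L k \<Longrightarrow> t \<in> qmod n a I L k \<Longrightarrow> s + t \<in> qmod n a I L k"
  by (induction rule: qmod.induct) (auto simp: add.assoc intro: qmod.intros)

lemma qmod_base:
  "p \<in> polys_le n k \<Longrightarrow> p\<^sup>2 \<in> qmod n a I L k"
  "\<forall>i\<in>I. v i \<in> polys_le n k \<Longrightarrow> quad_form I a v \<in> qmod n a I L k"
  "l \<in> L \<Longrightarrow> l \<in> qmod n a I L k"
  using qmod_square[OF _ qmod_0] qmod_form[OF _ qmod_0] qmod_lin[OF _ polys_le_1 qmod_0, of l L]
  by auto

lemma qmod_sum_list: "(\<And>x. x \<in> set xs \<Longrightarrow> g x \<in> qmod n a I L k) \<Longrightarrow> (\<Sum>x\<leftarrow>xs. g x) \<in> qmod n a I L k"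
  by (induction xs) (auto intro: qmod_0 qmod_add)

text \<open>Every generator absorbs the factor: \<open>p\<close> enters the squared polynomial or
  the vector, and \<open>p\<^sup>2\<close> enters the cofactor of an element of
  \<open>L\<close>.\<close>

lemma qmod_mult_square:
  assumes "s \<in> qmod n a I L k" and p: "p \<in> polys_le n r"
  shows "p\<^sup>2 * s \<in> qmod n a I L (k + r)"
  using assms(1)
proof (induction rule: qmod.induct)
  case (qmod_square q s)
  have "(p * q)\<^sup>2 + p\<^sup>2 * s \<in> qmod n a I L (k + r)"
    using polys_le_mult[OF p qmod_square(1)] qmod_square
    by (intro qmod.qmod_square) (simp_all add: add.commute)
  then show ?case by (simp add: distrib_left power_mult_distrib)
next
  case (qmod_form v s)
  have "quad_form I a (\<lambda>i. p * v i) + p\<^sup>2 * s \<in> qmod n a I L (k + r)"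
    using polys_le_mult[OF p] qmod_form by (intro qmod.qmod_form) (auto simp: add.commute)
  then show ?case by (simp add: distrib_left quad_form_scale)
next
  case (qmod_lin l q s)
  have "p\<^sup>2 * q \<in> polys_le n (2 * (k + r))"
    using polys_le_mult[OF polys_le_mult[OF p p] qmod_lin(2)]
    by (simp add: power2_eq_square mult_2 add_ac)
  then have "l * (p\<^sup>2 * q) + p\<^sup>2 * s \<in> qmod n a I L (k + r)"
    using qmod_lin by (intro qmod.qmod_lin)
  then show ?case by (simp add: algebra_simps)
qed (simp add: qmod.qmod_0)

lemma qmod_scale:
  assumes "s \<in> qmod n a I L k" "0 \<le> c"
  shows "const c * s \<in> qmod n a I L k"
proof -
  have "(const (sqrt c))\<^sup>2 = const c"
    using assms(2) by (simp add: power2_eq_square mult_single)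
  then show ?thesis using qmod_mult_square[OF assms(1) polys_le_const[of "sqrt c" n 0]] by simp
qed

lemma qmod_minus_one:
  assumes "- const c \<in> qmod n a I L k" "0 < c"
  shows "- 1 \<in> qmod n a I L k"
  using qmod_scale[OF assms(1), of "1 / c"] assms(2) by (simp add: mult_single)

lemma qmod_mono:
  assumes "s \<in> qmod n a I L k" and I: "I \<subseteq> I'" "finite I'" and L: "L \<subseteq> L'" and k: "k \<le> k'"
  shows "s \<in> qmod n a I' L' k'"
  using assms(1)
proof (induction rule: qmod.induct)
  case (qmod_form v s)
  have "quad_form I' a (\<lambda>i. if i \<in> I then v i else 0) + s \<in> qmod n a I' L' k'"
    using qmod_form polys_le_mono[OF _ k] by (intro qmod.qmod_form) (auto intro: polys_le_0)
  then show ?case by (simp add: quad_form_superset I)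
next
  case (qmod_lin l q s)
  then show ?case using L k by (intro qmod.qmod_lin) (auto intro: polys_le_mono)
qed (use k in \<open>auto intro: qmod.intros polys_le_mono\<close>)

text \<open>With \<open>p = -(1 + a j j) / 2\<close>, the form at \<open>p u + \<rho>\<^sub>j e\<^sub>j\<close> equals \<open>p\<^sup>2 (u\<^sup>T a u) - \<rho>\<^sub>j\<^sup>2\<close>.\<close>

lemma minus_row_square_in_qmod:
  fixes u :: "nat \<Rightarrow> real"
  assumes I: "finite I" "j \<in> I" and sym: "\<And>i j. i \<in> I \<Longrightarrow> j \<in> I \<Longrightarrow> a i j = a j i"
    and deg: "\<And>i j. i \<in> I \<Longrightarrow> j \<in> I \<Longrightarrow> a i j \<in> polys_le n 1"
    and neg: "- quad_form I a (\<lambda>i. const (u i)) \<in> qmod n a I L 0"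
  shows "- (\<Sum>i\<in>I. const (u i) * a i j)\<^sup>2 \<in> qmod n a I L 1"
proof -
  define p where "p = const (-1/2) * (1 + a j j)"
  define r where "r = (\<Sum>i\<in>I. const (u i) * a i j)"
  define s where "s = quad_form I a (\<lambda>i. const (u i))"
  have p: "p \<in> polys_le n 1" and r: "r \<in> polys_le n 1"
    unfolding p_def r_def by (intro polys_le_scale polys_le_add polys_le_1 polys_le_sum deg I; assumption)+
  define y where "y = (\<lambda>i. if i = j then r else 0)"
  have "2 * p = - (1 + a j j)"
  proof -
    have "2 * const (-1/2) = (- 1 :: mpoly)"
      by (simp add: mult_2 flip: single_add) (simp add: single_uminus)
    then show ?thesis by (simp only: p_def mult.assoc[symmetric]) simp
  qed
  moreover have "quad_form I a (\<lambda>i. p * const (u i) + y i) = p\<^sup>2 * s + 2 * p * r\<^sup>2 + a j j * r\<^sup>2"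
  proof -
    have y: "sum (\<lambda>i. g i * y i) I = g j * r" "sum (\<lambda>i. y i * g i) I = r * g j" for g
    proof -
      have "sum (\<lambda>i. g i * y i) I = (\<Sum>i\<in>I. if i = j then g j * r else 0)"
        by (rule sum.cong) (auto simp: y_def)
      then show "sum (\<lambda>i. g i * y i) I = g j * r" using I by simp
      then show "sum (\<lambda>i. y i * g i) I = r * g j" by (simp add: mult.commute)
    qed
    have "quad_form I a y = r * (a j j * r)"
      by (simp only: quad_form_def y mult.assoc flip: sum_distrib_left)
    moreover have "(\<Sum>j\<in>I. (\<Sum>i\<in>I. p * const (u i) * a i j) * y j) = p * r * r"
      by (simp only: y) (simp add: r_def sum_distrib_left mult.assoc)
    moreover have "quad_form I a (\<lambda>i. p * const (u i)) = p\<^sup>2 * s"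
      by (simp add: quad_form_scale s_def)
    ultimately show ?thesis
      by (subst quad_form_add[OF sym]) (simp_all add: power2_eq_square mult_ac)
  qed
  ultimately have e: "- r\<^sup>2 = quad_form I a (\<lambda>i. p * const (u i) + y i) + p\<^sup>2 * (- s)"
    by (simp only:) (simp add: algebra_simps)
  have "\<forall>i\<in>I. p * const (u i) + y i \<in> polys_le n 1"
    using r polys_le_scale[OF p] by (auto simp: y_def mult.commute[of p] intro!: polys_le_add polys_le_0)
  moreover have "p\<^sup>2 * (- s) \<in> qmod n a I L 1"
    using qmod_mult_square[OF neg p] by (simp add: s_def)
  ultimately have "- r\<^sup>2 \<in> qmod n a I L 1"
    unfolding e by (intro qmod_add qmod_base(2))
  then show ?thesis by (simp add: r_def)
qed

text \<open>Uses \<open>-(x + y)\<^sup>2 = -2 x\<^sup>2 - 2 y\<^sup>2 + (x - y)\<^sup>2\<close>.\<close>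

lemma minus_combination_square_in_qmod:
  assumes "finite J" "\<And>j. j \<in> J \<Longrightarrow> - (r j)\<^sup>2 \<in> qmod n a I L 1"
    and "\<And>j. j \<in> J \<Longrightarrow> r j \<in> polys_le n 1" "\<And>j. j \<in> J \<Longrightarrow> q j \<in> polys_le n m"
  shows "- (\<Sum>j\<in>J. r j * q j)\<^sup>2 \<in> qmod n a I L (1 + m)"
  using assms
proof (induction J rule: finite_induct)
  case empty
  then show ?case by (simp add: qmod_0)
next
  case (insert i J)
  define x where "x = r i * q i"
  define y where "y = (\<Sum>j\<in>J. r j * q j)"
  have "- y\<^sup>2 \<in> qmod n a I L (1 + m)" using insert by (simp add: y_def)
  moreover have "- x\<^sup>2 \<in> qmod n a I L (1 + m)"
    using qmod_mult_square[of "- (r i)\<^sup>2" n a I L 1 "q i" m] insert.prems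
    by (simp add: x_def power_mult_distrib mult.commute)
  moreover have "(x - y)\<^sup>2 \<in> qmod n a I L (1 + m)"
    unfolding x_def y_def using insert.prems
    by (intro qmod_base polys_le_diff polys_le_sum polys_le_mult) auto
  ultimately have "(- x\<^sup>2) + (- x\<^sup>2) + ((- y\<^sup>2) + (- y\<^sup>2)) + (x - y)\<^sup>2 \<in> qmod n a I L (1 + m)"
    by (intro qmod_add)
  moreover have "(- x\<^sup>2) + (- x\<^sup>2) + ((- y\<^sup>2) + (- y\<^sup>2)) + (x - y)\<^sup>2 = - (x + y)\<^sup>2"
    by (simp add: power2_eq_square algebra_simps)
  moreover have "(\<Sum>j\<in>insert i J. r j * q j) = x + y"
    using insert.hyps by (simp add: x_def y_def)
  ultimately show ?case by (simp only:)
qed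

text \<open>Each element of \<open>L'\<close> in the certificate is split into its part in
  \<open>L\<close> and a combination of the \<open>r j\<close>. The cofactors of \<open>r j\<close>
  are collected in \<open>q j\<close>; their degree stays below \<open>2 * k\<close> or equal to it
  because the \<open>c j\<close> are constants.\<close>

lemma qmod_eliminate:
  assumes "s \<in> qmod n a I L' k" and J: "finite J"
    and L': "\<And>l. l \<in> L' \<Longrightarrow> \<exists>l0\<in>L. \<exists>c. l = l0 + (\<Sum>j\<in>J. const (c j) * r j)"
  shows "\<exists>q. (\<forall>j\<in>J. q j \<in> polys_le n (2 * k)) \<and> s - (\<Sum>j\<in>J. r j * q j) \<in> qmod n a I L k"
  using assms(1)
proof (induction rule: qmod.induct)
  case qmod_0
  then show ?case by (intro exI[of _ "\<lambda>_. 0"]) (auto intro: polys_le_0 qmod.qmod_0)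
next
  case (qmod_square p s)
  then show ?case using qmod.qmod_square[OF qmod_square(1)] by (auto simp flip: add_diff_eq)
next
  case (qmod_form v s)
  then show ?case using qmod.qmod_form[OF qmod_form(1)] by (auto simp flip: add_diff_eq)
next
  case (qmod_lin l q s)
  obtain q' where q': "\<forall>j\<in>J. q' j \<in> polys_le n (2 * k)"
    "s - (\<Sum>j\<in>J. r j * q' j) \<in> qmod n a I L k"
    using qmod_lin by blast
  obtain l0 c where l: "l0 \<in> L" "l = l0 + (\<Sum>j\<in>J. const (c j) * r j)"
    using L'[OF qmod_lin(1)] by blast
  have "l * q + s - (\<Sum>j\<in>J. r j * (q' j + const (c j) * q)) = l0 * q + (s - (\<Sum>j\<in>J. r j * q' j))"
    by (simp add: l(2) sum.distrib sum_distrib_left sum_distrib_right algebra_simps)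
  then have "l * q + s - (\<Sum>j\<in>J. r j * (q' j + const (c j) * q)) \<in> qmod n a I L k"
    using qmod.qmod_lin[OF l(1) qmod_lin(2) q'(2)] by (simp only:)
  moreover have "\<forall>j\<in>J. q' j + const (c j) * q \<in> polys_le n (2 * k)"
    using q'(1) qmod_lin(2) by (auto intro: polys_le_add polys_le_scale)
  ultimately show ?case by (intro exI[of _ "\<lambda>j. q' j + const (c j) * q"] conjI)
qed

text \<open>Steinitz exchange relative to \<open>L\<close>: once \<open>r\<close> is added to
  \<open>L\<close>, one element of \<open>E\<close> becomes redundant. This is how the codimension
  drops in the induction.\<close>

lemma codim_exchange:
  assumes "finite E" "r \<in> mp.span (L \<union> E)" "r \<notin> mp.span L"
  shows "\<exists>e\<in>E. e \<in> mp.span (insert r (L \<union> (E - {e})))"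
  using assms
proof (induction E rule: finite_induct)
  case empty
  then show ?case by simp
next
  case (insert e E)
  show ?case
  proof (cases "r \<in> mp.span (L \<union> E)")
    case True
    then obtain e' where "e' \<in> E" "e' \<in> mp.span (insert r (L \<union> (E - {e'})))"
      using insert by blast
    moreover have "insert r (L \<union> (E - {e'})) \<subseteq> insert r (L \<union> (insert e E - {e'}))" by blast
    ultimately show ?thesis using mp.span_mono by blast
  next
    case False
    have "r \<in> mp.span (insert e (L \<union> E))" using insert.prems(1) by simp
    then have "e \<in> mp.span (insert r (L \<union> E))" using False by (rule mp.in_span_insert)
    then show ?thesis using insert.hyps by (intro bexI[of _ e]) simp_all
  qed
qed

text \<open>Modulo \<open>L\<close> every affine polynomial is a constant, so the pencil is a constant matrix.\<close>

lemma certificate_codim_one: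
  assumes L: "mp.subspace L" and I: "finite I"
    and deg: "\<And>i j. i \<in> I \<Longrightarrow> j \<in> I \<Longrightarrow> a i j \<in> polys_le n 1"
    and infeas: "pencil_infeasible L I a"
    and E: "finite E" "card E \<le> 1" "polys_le n 1 \<subseteq> mp.span (L \<union> E)"
  shows "- 1 \<in> qmod n a I L k"
proof (cases "1 \<in> L")
  case True
  then have "- 1 \<in> L" using L mp.subspace_neg by blast
  then show ?thesis by (rule qmod_base)
next
  case False
  have spanL: "mp.span L = L" using L by simp
  have "1 \<in> mp.span (L \<union> E)" using E(3) polys_le_1 by blast
  moreover have "1 \<notin> mp.span L" unfolding spanL by (rule False)
  \<comment> \<open>As \<open>1\<close> is not in \<open>L\<close>, it can replace the only element
    of \<open>E\<close>.\<close>
  ultimately obtain e where "e \<in> E" and e: "e \<in> mp.span (insert 1 (L \<union> (E - {e})))"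
    using codim_exchange[OF E(1)] by blast
  then have Ee: "E = {e}" using E(2) card_le_Suc0_iff_eq[OF E(1)] by auto
  have "L \<union> E \<subseteq> mp.span (insert 1 L)"
    using e by (auto simp: Ee intro: mp.span_base)
  then have aff: "polys_le n 1 \<subseteq> mp.span (insert 1 L)"
    using E(3) mp.span_minimal[OF _ mp.subspace_span] by blast
  \<comment> \<open>A functional that vanishes on \<open>L\<close> but not at \<open>1\<close>
    gives, after normalisation, the point at which infeasibility is used.\<close>
  have "finite {1 :: mpoly}" by simp
  then obtain F where F: "\<forall>f\<in>F. linear_fun f" "\<forall>f\<in>F. \<forall>v\<in>L. f v = 0"
    "\<forall>v\<in>mp.span {1}. (\<forall>f\<in>F. f v = 0) \<longrightarrow> v \<in> L"
    by (rule separating_functionals[OF L])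
  have "1 \<in> mp.span {1}" by (rule mp.span_base) simp
  then have "\<not> (\<forall>f\<in>F. f 1 = 0)" using bspec[OF F(3)] False by blast
  then obtain f where f: "f \<in> F" "f 1 \<noteq> 0" by blast
  define g where "g v = f v / f 1" for v
  have g: "linear_fun g" "g 1 = 1" "\<forall>v\<in>L. g v = 0"
    unfolding g_def using linear_fun_divide[OF bspec[OF F(1) f(1)]] f(2) bspec[OF bspec[OF F(2) f(1)]]
    by auto
  obtain u where u: "quad_form I (\<lambda>i j. g (a i j)) u < 0"
    using infeas[unfolded pencil_infeasible_def, THEN spec[of _ g]] g by blast
  define v where "v = quad_form I a (\<lambda>i. const (u i))"
  have gv: "g v < 0" using u by (simp add: v_def linear_fun_quad_form[OF g(1)])
  have "v \<in> polys_le n 1"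
    unfolding v_def const_quad_form by (intro polys_le_sum polys_le_scale deg)
  \<comment> \<open>Modulo \<open>L\<close> the value \<open>v\<close> of the form is the constant
    \<open>g v\<close>, which is negative.\<close>
  then obtain c where c: "v - const c * 1 \<in> L"
    using aff mp.span_breakdown_eq[of v 1 L] spanL by auto
  then have "c = g v"
    using bspec[OF g(3) c] by (simp add: linear_funD[OF g(1)] linear_fun_const[OF g(1)] g(2))
  then have "- (v - const (g v)) \<in> L" using mp.subspace_neg[OF L c] by simp
  then have "- (v - const (g v)) \<in> qmod n a I L k" by (rule qmod_base)
  moreover have "v \<in> qmod n a I L k"
    unfolding v_def by (intro qmod_base ballI polys_le_const)
  ultimately have "v + - (v - const (g v)) \<in> qmod n a I L k" by (rule qmod_add[rotated])
  then have "- const (- g v) \<in> qmod n a I L k" by (simp add: single_uminus)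
  then show ?thesis by (rule qmod_minus_one) (use gv in simp)
qed

text \<open>Eliminating \<open>L'\<close> leaves \<open>-1 - h\<close> in the module of degree
  \<open>k\<close>. As \<open>h\<close> has degree at most \<open>1 + 2 * k\<close>, the square
  \<open>(1 + h)\<^sup>2\<close> is admissible there, and \<open>- h\<^sup>2\<close> comes from the
  squares of the \<open>r j\<close>.\<close>

lemma certificate_doubling:
  assumes J: "finite J" and "- 1 \<in> qmod n a I L' k"
    and "\<And>l. l \<in> L' \<Longrightarrow> \<exists>l0\<in>L. \<exists>c. l = l0 + (\<Sum>j\<in>J. const (c j) * r j)"
    and r: "\<And>j. j \<in> J \<Longrightarrow> - (r j)\<^sup>2 \<in> qmod n a I L 1" "\<And>j. j \<in> J \<Longrightarrow> r j \<in> polys_le n 1"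
    and I: "finite I"
  shows "- 1 \<in> qmod n a I L (1 + 2 * k)"
proof -
  obtain q where q: "\<And>j. j \<in> J \<Longrightarrow> q j \<in> polys_le n (2 * k)"
    and h: "- 1 - (\<Sum>j\<in>J. r j * q j) \<in> qmod n a I L k"
    using qmod_eliminate[OF assms(2) J assms(3)] by blast
  define h where "h = (\<Sum>j\<in>J. r j * q j)"
  have 1: "- 1 - h \<in> qmod n a I L (1 + 2 * k)"
    using qmod_mono[OF h order_refl I order_refl] by (simp add: h_def)
  have 2: "(1 + h)\<^sup>2 \<in> qmod n a I L (1 + 2 * k)"
    unfolding h_def by (intro qmod_base polys_le_add polys_le_1 polys_le_sum polys_le_mult r q)
  have 3: "- h\<^sup>2 \<in> qmod n a I L (1 + 2 * k)"
    unfolding h_def by (intro minus_combination_square_in_qmod J r q)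
  have e: "- 1 = (- 1 - h) + (- 1 - h) + (1 + h)\<^sup>2 + (- h\<^sup>2)"
    by (simp add: power2_eq_square algebra_simps)
  show ?thesis by (subst e) (intro qmod_add 1 2 3)
qed

text \<open>The number \<open>d\<close> may bound either the size of the submatrix or the zero set:
  in the second disjunct the affine polynomials have dimension at most \<open>d + 1\<close> modulo
  \<open>L\<close>, so the zero set has dimension at most \<open>d\<close>. An induction step that
  enlarges \<open>L\<close> lowers \<open>d\<close> by one, whichever bound holds.\<close>

lemma certificate:
  assumes "finite I" "mp.subspace L"
    and "\<And>i j. i \<in> I \<Longrightarrow> j \<in> I \<Longrightarrow> a i j = a j i"
    and "\<And>i j. i \<in> I \<Longrightarrow> j \<in> I \<Longrightarrow> a i j \<in> polys_le n 1"
    and "pencil_infeasible L I a"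
    and "card I \<le> d + 1 \<or> (\<exists>E. finite E \<and> card E \<le> d + 1 \<and> polys_le n 1 \<subseteq> mp.span (L \<union> E))"
  shows "- 1 \<in> qmod n a I L (2 ^ d - 1)"
  using assms
proof (induction I arbitrary: L d rule: finite_psubset_induct)
  case (psubset I)
  note I = \<open>finite I\<close> and L = psubset.prems(1) and sym = psubset.prems(2)
    and deg = psubset.prems(3) and infeas = psubset.prems(4) and dim = psubset.prems(5)
  let ?q = "\<lambda>u. quad_form I a (\<lambda>i. const (u i))"
  have q_mem: "?q u \<in> qmod n a I L k" for u k
    by (intro qmod_base ballI polys_le_const)
  obtain us c where us: "(\<Sum>u\<leftarrow>us. ?q u) + const c \<in> L" "0 \<le> c"
    "0 < c \<or> (\<exists>u\<in>set us. \<exists>k\<in>I. u k \<noteq> 0)"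
    using pencil_alternative[OF L I infeas] by blast
  show ?case
  proof (cases "0 < c")
    case True
    have "(\<Sum>u\<leftarrow>us. ?q u) + - ((\<Sum>u\<leftarrow>us. ?q u) + const c) \<in> qmod n a I L (2 ^ d - 1)"
      using mp.subspace_neg[OF L us(1)] by (intro qmod_add qmod_sum_list q_mem qmod_base(3))
    then show ?thesis using True by (intro qmod_minus_one[of c]) simp_all
  next
    case False
    then have sum_L: "(\<Sum>u\<leftarrow>us. ?q u) \<in> L" using us(1,2) by simp
    obtain u i where u: "u \<in> set us" "i \<in> I" "u i \<noteq> 0" using us(3) False by blast
    define r where "r j = (\<Sum>i\<in>I. const (u i) * a i j)" for j
    \<comment> \<open>The whole sum lies in \<open>L\<close>, so \<open>- ?q u\<close> is the sum of
      the other forms minus an element of \<open>L\<close>.\<close>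
    have neg: "- ?q u \<in> qmod n a I L 0"
    proof -
      obtain us1 us2 where "us = us1 @ u # us2" using split_list[OF u(1)] by blast
      then have "- ?q u = (\<Sum>u\<leftarrow>us1 @ us2. ?q u) + - (\<Sum>u\<leftarrow>us. ?q u)"
        by simp
      also have "\<dots> \<in> qmod n a I L 0"
        using mp.subspace_neg[OF L sum_L] by (intro qmod_add qmod_sum_list q_mem qmod_base(3))
      finally show ?thesis .
    qed
    have r_deg: "r j \<in> polys_le n 1" if "j \<in> I" for j
      unfolding r_def using that by (intro polys_le_sum polys_le_scale deg)
    \<comment> \<open>The zero set of \<open>L'\<close> consists of the zeros of \<open>L\<close> at
      which \<open>u\<close> is in the kernel of the submatrix.\<close>
    define L' where "L' = {l + (\<Sum>j\<in>I. const (c j) * r j) |l c. l \<in> L}"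
    have L': "mp.subspace L'"
      unfolding mp.subspace_def
    proof (intro conjI ballI allI)
      show "0 \<in> L'" unfolding L'_def using mp.subspace_0[OF L]
        by (intro CollectI exI[of _ 0] exI[of _ "\<lambda>_. 0"]) simp
    next
      fix x y assume "x \<in> L'" "y \<in> L'"
      then obtain l c l' c' where "l \<in> L" "l' \<in> L"
        "x = l + (\<Sum>j\<in>I. const (c j) * r j)" "y = l' + (\<Sum>j\<in>I. const (c' j) * r j)"
        unfolding L'_def by blast
      then have "x + y = (l + l') + (\<Sum>j\<in>I. const (c j + c' j) * r j)" "l + l' \<in> L"
        using mp.subspace_add[OF L] by (simp_all add: single_add distrib_right sum.distrib)
      then show "x + y \<in> L'" unfolding L'_def
        by (intro CollectI exI[of _ "l + l'"] exI[of _ "\<lambda>j. c j + c' j"] conjI)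
    next
      fix t x assume "x \<in> L'"
      then obtain l c where "l \<in> L" "x = l + (\<Sum>j\<in>I. const (c j) * r j)"
        unfolding L'_def by blast
      then have "const t * x = const t * l + (\<Sum>j\<in>I. const (t * c j) * r j)" "const t * l \<in> L"
        using mp.subspace_scale[OF L] by (simp_all add: distrib_left sum_distrib_left mult_single flip: mult.assoc)
      then show "const t * x \<in> L'" unfolding L'_def
        by (intro CollectI exI[of _ "const t * l"] exI[of _ "\<lambda>j. t * c j"] conjI)
    qed
    have LL': "L \<subseteq> L'"
    proof
      fix l assume "l \<in> L"
      then show "l \<in> L'" unfolding L'_def
        by (intro CollectI exI[of _ l] exI[of _ "\<lambda>_. 0"]) simp
    qed
    have rL': "r j \<in> L'" if "j \<in> I" for j
    proof -
      have "(\<Sum>k\<in>I. const (if k = j then 1 else 0) * r k) = (\<Sum>k\<in>I. if k = j then r j else 0)"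
        by (rule sum.cong) auto
      then have "(\<Sum>k\<in>I. const (if k = j then 1 else 0) * r k) = r j" using that I by simp
      then show ?thesis unfolding L'_def using mp.subspace_0[OF L]
        by (intro CollectI exI[of _ 0] exI[of _ "\<lambda>k. if k = j then 1 else 0"]) simp
    qed
    have infeas': "pencil_infeasible L' (I - {i}) a"
      unfolding pencil_infeasible_def
    proof (intro allI impI, elim conjE)
      fix f assume f: "linear_fun f" "f 1 = 1" "\<forall>v\<in>L'. f v = 0"
      obtain w where w: "quad_form I (\<lambda>i j. f (a i j)) w < 0"
        using infeas[unfolded pencil_infeasible_def, THEN spec[of _ f]] f LL' by blast
      define x where "x k = - (w i / u i) * u k" for k
      have "(\<Sum>k\<in>I. u k * f (a k j)) = 0" if "j \<in> I" for j
        using bspec[OF f(3) rL'[OF that]] by (simp add: r_def linear_fun_sum[OF f(1)] linear_funD[OF f(1)])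
      then have x0: "(\<Sum>k\<in>I. x k * f (a k j)) = 0" if "j \<in> I" for j
        using that by (simp add: x_def mult.assoc sum_negf flip: sum_divide_distrib sum_distrib_left)
      have "quad_form I (\<lambda>i j. f (a i j)) x = (\<Sum>j\<in>I. (\<Sum>k\<in>I. x k * f (a k j)) * x j)"
        unfolding quad_form_def by (subst sum.swap) (simp add: sum_distrib_right)
      moreover have "quad_form I (\<lambda>i j. f (a i j)) (\<lambda>k. x k + w k) = quad_form I (\<lambda>i j. f (a i j)) x +
        2 * (\<Sum>j\<in>I. (\<Sum>k\<in>I. x k * f (a k j)) * w j) + quad_form I (\<lambda>i j. f (a i j)) w"
        by (rule quad_form_add) (simp add: sym)
      ultimately have "quad_form I (\<lambda>i j. f (a i j)) (\<lambda>k. x k + w k) = quad_form I (\<lambda>i j. f (a i j)) w"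
        by (simp add: x0)
      moreover have "quad_form I (\<lambda>i j. f (a i j)) (\<lambda>k. x k + w k) =
        quad_form (I - {i}) (\<lambda>i j. f (a i j)) (\<lambda>k. x k + w k)"
        by (rule quad_form_remove) (use I u in \<open>auto simp: x_def\<close>)
      ultimately show "\<exists>w. quad_form (I - {i}) (\<lambda>i j. f (a i j)) w < 0" using w by metis
    qed
    have I': "I - {i} \<subset> I" using u by blast
    have card_I': "card (I - {i}) = card I - 1" using u I by simp
    show ?thesis
    \<comment> \<open>If the rows add nothing to \<open>L\<close>, the index is dropped at no cost
      in degree.\<close>
    proof (cases "\<forall>j\<in>I. r j \<in> L")
      case True
      have "L' \<subseteq> L"
        unfolding L'_def using True L
        by (auto intro!: mp.subspace_add mp.subspace_sum mp.subspace_scale)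
      then have eq: "L' = L" using LL' by blast
      have "- 1 \<in> qmod n a (I - {i}) L (2 ^ d - 1)"
      proof (rule psubset.IH[OF I' L])
        show "card (I - {i}) \<le> d + 1 \<or>
          (\<exists>E. finite E \<and> card E \<le> d + 1 \<and> polys_le n 1 \<subseteq> mp.span (L \<union> E))"
          using dim card_I' by auto
      qed (use sym deg infeas' eq in auto)
      then show ?thesis by (rule qmod_mono) (use I in auto)
    next
      case False
      then obtain j0 where j0: "j0 \<in> I" "r j0 \<notin> L" by blast
      show ?thesis
      proof (cases d)
        case 0
        \<comment> \<open>For a single index, \<open>L\<close> contains a positive multiple of
          \<open>a i i\<close> and hence \<open>r i\<close>, contrary to the case assumption. So for
          \<open>d = 0\<close> the codimension bound must hold.\<close>
        have "card I \<noteq> 1"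
        proof
          assume "card I = 1"
          then have Ii: "I = {i}" using u(2) by (metis card_1_singletonE singletonD)
          define t where "t = (\<Sum>u\<leftarrow>us. (u i)\<^sup>2)"
          have "(u i)\<^sup>2 \<le> t" unfolding t_def
            by (rule member_le_sum_list) (use u(1) in auto)
          moreover have "0 < (u i)\<^sup>2" using u(3) by simp
          ultimately have "0 < t" by linarith
          have "?q w = const ((w i)\<^sup>2) * a i i" for w
            by (simp add: const_quad_form Ii power2_eq_square)
          then have "(\<Sum>u\<leftarrow>us. ?q u) = const t * a i i"
            by (simp add: t_def) (induction us, simp_all add: single_add distrib_right)
          then have "const (u i / t) * (const t * a i i) \<in> L"
            using mp.subspace_scale[OF L sum_L, of "u i / t"] by (simp only:)
          moreover have "const (u i / t) * (const t * a i i) = r i"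
            using \<open>0 < t\<close> by (simp add: r_def Ii mult_single flip: mult.assoc)
          ultimately show False using j0 Ii by simp
        qed
        moreover have "card I \<noteq> 0" using u(2) I by auto
        ultimately obtain E where "finite E" "card E \<le> 1" "polys_le n 1 \<subseteq> mp.span (L \<union> E)"
          using dim 0 by auto
        then show ?thesis using certificate_codim_one[OF L I deg infeas] by blast
      next
        case (Suc d')
        have "- 1 \<in> qmod n a (I - {i}) L' (2 ^ d' - 1)"
        proof (rule psubset.IH[OF I' L'])
          show "card (I - {i}) \<le> d' + 1 \<or>
            (\<exists>E. finite E \<and> card E \<le> d' + 1 \<and> polys_le n 1 \<subseteq> mp.span (L' \<union> E))"
          \<comment> \<open>A size bound improves because \<open>i\<close> is removed; a codimension
            bound improves by exchanging an element of \<open>E\<close> for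
            \<open>r j0\<close>.\<close>
          proof (cases "card I \<le> d + 1")
            case True
            then have "card (I - {i}) \<le> d' + 1" using card_I' Suc by linarith
            then show ?thesis ..
          next
            case False
            then obtain E where E: "finite E" "card E \<le> d + 1" "polys_le n 1 \<subseteq> mp.span (L \<union> E)"
              using dim by blast
            have "r j0 \<in> mp.span (L \<union> E)" using E(3) r_deg[OF j0(1)] by blast
            moreover have "r j0 \<notin> mp.span L" unfolding mp.span_eq_iff[THEN iffD2, OF L] by (rule j0(2))
            ultimately obtain e where e: "e \<in> E" "e \<in> mp.span (insert (r j0) (L \<union> (E - {e})))"
              using codim_exchange[OF E(1)] by blast
            have "insert (r j0) (L \<union> (E - {e})) \<subseteq> L' \<union> (E - {e})" using rL' j0(1) LL' by blast
            then have "e \<in> mp.span (L' \<union> (E - {e}))" using e(2) mp.span_mono by blast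
            then have "L \<union> E \<subseteq> mp.span (L' \<union> (E - {e}))"
              using LL' by (auto intro: mp.span_base)
            then have "polys_le n 1 \<subseteq> mp.span (L' \<union> (E - {e}))"
              using E(3) mp.span_minimal[OF _ mp.subspace_span] by blast
            moreover have "card (E - {e}) \<le> d' + 1" using E e Suc by simp
            ultimately show ?thesis using E(1) by blast
          qed
        qed (use sym deg infeas' in auto)
        then have "- 1 \<in> qmod n a I L' (2 ^ d' - 1)" by (rule qmod_mono) (use I in auto)
        moreover have "\<exists>l0\<in>L. \<exists>c. l = l0 + (\<Sum>j\<in>I. const (c j) * r j)" if "l \<in> L'" for l
          using that unfolding L'_def by blast
        moreover have "- (r j)\<^sup>2 \<in> qmod n a I L 1" if "j \<in> I" for j
          unfolding r_def using minus_row_square_in_qmod[OF I that sym deg neg] .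
        ultimately have "- 1 \<in> qmod n a I L (1 + 2 * (2 ^ d' - 1))"
          using r_deg I by (intro certificate_doubling[OF I])
        \<comment> \<open>Subtraction of natural numbers is truncated, so the doubling of the
          exponent needs \<open>1 \<le> x\<close> for \<open>x = 2 ^ d'\<close>.\<close>
        moreover have "1 \<le> x \<Longrightarrow> 1 + 2 * (x - 1) = 2 * x - 1" for x :: nat
          by arith
        then have "1 + 2 * (2 ^ d' - 1) = (2 ^ d - 1 :: nat)"
          unfolding Suc power_Suc by simp
        ultimately show ?thesis by (simp only:)
      qed
    qed
  qed
qed

section \<open>Transfer to matrices and the truncated quadratic module\<close>

lemma scalar_prod_mult_mat_vec_eq_quad_form:
  assumes "A \<in> carrier_mat m m" "v \<in> carrier_vec m"
  shows "v \<bullet> (A *\<^sub>v v) = quad_form {..<m} (\<lambda>i j. A $$ (i, j)) (\<lambda>i. v $ i)"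
  using assms
  by (simp add: scalar_prod_def quad_form_def sum_distrib_left mult_ac lessThan_atLeast0)

text \<open>For \<open>L = {0}\<close> the generators \<open>l * q\<close> are zero, and the
  remaining ones are collected in the two lists.\<close>

lemma qmod_subset_trunc_quadratic_module:
  assumes "s \<in> qmod n (\<lambda>i j. A $$ (i, j)) {..<m} {0} k" and A: "A \<in> carrier_mat m m"
  shows "s \<in> trunc_quadratic_module n k A"
  using assms(1)
proof (induction rule: qmod.induct)
  case qmod_0
  show ?case unfolding trunc_quadratic_module_def
    by (intro CollectI exI[of _ "[]"]) simp
next
  case (qmod_square p s)
  then obtain ps vs where "s = (\<Sum>p\<leftarrow>ps. p\<^sup>2) + (\<Sum>v\<leftarrow>vs. v \<bullet> (A *\<^sub>v v))"
    "set ps \<subseteq> polys_le n k" "set vs \<subseteq> poly_vecs_le n k (dim_row A)"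
    unfolding trunc_quadratic_module_def by blast
  then show ?case unfolding trunc_quadratic_module_def using qmod_square(1)
    by (intro CollectI exI[of _ "p # ps"] exI[of _ vs]) (simp add: add.assoc)
next
  case (qmod_form v s)
  then obtain ps vs where "s = (\<Sum>p\<leftarrow>ps. p\<^sup>2) + (\<Sum>v\<leftarrow>vs. v \<bullet> (A *\<^sub>v v))"
    "set ps \<subseteq> polys_le n k" "set vs \<subseteq> poly_vecs_le n k (dim_row A)"
    unfolding trunc_quadratic_module_def by blast
  moreover have "vec m v \<bullet> (A *\<^sub>v vec m v) = quad_form {..<m} (\<lambda>i j. A $$ (i, j)) v"
    unfolding scalar_prod_mult_mat_vec_eq_quad_form[OF A vec_carrier]
    by (rule quad_form_cong) auto
  moreover have "vec m v \<in> poly_vecs_le n k (dim_row A)"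
    using A qmod_form(1) by (simp add: poly_vecs_le_def)
  ultimately show ?case unfolding trunc_quadratic_module_def
    by (intro CollectI exI[of _ ps] exI[of _ "vec m v # vs"]) (simp add: add_ac)
qed simp

theorem theorem4p3p3:
  fixes n \<alpha> :: nat and A :: "mpoly mat"
  assumes "linear_pencil n \<alpha> A"
    and "infeasible n A"
  shows "-1 \<in> trunc_quadratic_module n (2 ^ min (\<alpha> - 1) n - 1) A"
proof -
  have A: "A \<in> carrier_mat \<alpha> \<alpha>" and tA: "transpose_mat A = A"
    and deg: "\<And>i j. i < \<alpha> \<Longrightarrow> j < \<alpha> \<Longrightarrow> A $$ (i, j) \<in> polys_le n 1"
    using assms(1) by (auto simp: linear_pencil_def)
  have sym: "A $$ (i, j) = A $$ (j, i)" if "i < \<alpha>" "j < \<alpha>" for i j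
    using that A tA by (metis carrier_matD index_transpose_mat(1))
  have "- 1 \<in> qmod n (\<lambda>i j. A $$ (i, j)) {..<\<alpha>} {0} (2 ^ min (\<alpha> - 1) n - 1)"
  proof (rule certificate)
    show "mp.subspace {0}" by (rule mp.subspace_single_0)
    \<comment> \<open>The elements \<open>1\<close> and the \<open>n\<close> variables span the
      affine polynomials, which allows \<open>d = n\<close>; the size of the pencil allows
      \<open>d = \<alpha> - 1\<close>.\<close>
    let ?E = "insert 1 (var ` {..<n})"
    have "card ?E \<le> n + 1"
      using card_image_le[of "{..<n}" var] card_insert_le_m1[of "n + 1" "var ` {..<n}" 1] by simp
    moreover have "polys_le n 1 \<subseteq> mp.span ({0} \<union> ?E)"
      using affine_in_span mp.span_mono[of ?E "{0} \<union> ?E"] by blast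
    ultimately have "\<exists>E. finite E \<and> card E \<le> n + 1 \<and> polys_le n 1 \<subseteq> mp.span ({0} \<union> E)"
      by (intro exI[of _ ?E]) simp
    then show "card {..<\<alpha>} \<le> min (\<alpha> - 1) n + 1 \<or> (\<exists>E. finite E \<and> card E \<le> min (\<alpha> - 1) n + 1 \<and>
      polys_le n 1 \<subseteq> mp.span ({0} \<union> E))"
      by (cases "\<alpha> - 1 \<le> n") (auto simp: min_def)
    show "pencil_infeasible {0} {..<\<alpha>} (\<lambda>i j. A $$ (i, j))"
      unfolding pencil_infeasible_def
    proof (intro allI impI, elim conjE)
      fix f assume f: "linear_fun f" "f 1 = 1"
      \<comment> \<open>The functional is evaluation at \<open>x\<close> on the entries of
        \<open>A\<close>, so the pencil at \<open>x\<close> is the matrix of their images under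
        \<open>f\<close>.\<close>
      define x where "x = vec n (\<lambda>i. f (var i))"
      define B where "B = map_mat (poly_eval x) A"
      have B: "B \<in> carrier_mat \<alpha> \<alpha>" "\<And>i j. i < \<alpha> \<Longrightarrow> j < \<alpha> \<Longrightarrow> B $$ (i, j) = f (A $$ (i, j))"
        using A deg by (auto simp: B_def x_def poly_eval_affine[OF f] simp del: One_nat_def)
      have "\<not> pos_semidef B"
        using assms(2) by (auto simp: infeasible_def spectrahedron_def B_def x_def)
      moreover have "transpose_mat B = B"
        using B sym by (intro eq_matI) auto
      ultimately obtain u where u: "u \<in> carrier_vec \<alpha>" "u \<bullet> (B *\<^sub>v u) < 0"
        using B(1) by (auto simp: pos_semidef_def not_le)
      have "quad_form {..<\<alpha>} (\<lambda>i j. f (A $$ (i, j))) (\<lambda>i. u $ i) = u \<bullet> (B *\<^sub>v u)"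
        unfolding scalar_prod_mult_mat_vec_eq_quad_form[OF B(1) u(1)]
        by (rule quad_form_cong) (use B(2) in auto)
      then show "\<exists>u. quad_form {..<\<alpha>} (\<lambda>i j. f (A $$ (i, j))) u < 0" using u(2) by metis
    qed
  qed (use sym deg in auto)
  then show ?thesis using A by (rule qmod_subset_trunc_quadratic_module)
qed

end
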